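(* The following formulas hold in the ring of symmetric power series. (1) Let $n\ge 1$ and embed $\mathbb{Z}/n\mathbb{Z}$ in $\mathrm{GL}_1(\mathbb{C})$ by $j\mapsto e^{2\pi i j/n}$. Then $$\mathbb{E}[\mathrm{Exp}_\sigma(X_{\mathbb{Z}/n\mathbb{Z}}h_1)]=\sum_{\tau}\epsilon_\tau\, m_\tau,\qquad \epsilon_\tau=\begin{cases}1&\text{if } n\mid|\tau|\\0&\text{otherwise.}\end{cases}$$ (2) Let $D_n$ be the dihedral group with $2n$ elements, embedded in $\mathrm{GL}_2(\mathbb{C})$ by its usual action on the plane ($n$ rotations by multiples of $2\pi/n$ and $n$ reflections, regarded as $2\times 2$ matrices). Then $$\mathbb{E}[\mathrm{Exp}_\sigma(X_{D_n}h_1)]=\frac12\left(\sum_{\tau=(\tau_1,\ldots,\tau_s)}\#\Bigl\{(r_1,\ldots,r_s)\in\mathbb{Z}^s : 0\le r_i\le\tau_i \text{ for all } i,\ n\mid\bigl(|\tau|-2\textstyle\sum_i r_i\bigr)\Bigr\}\,m_\tau\right)+\frac12\mathrm{Exp}_\sigma(p_2).$$ (3) Let $P_n\le \mathrm{GL}_{2^n}(\mathbb{C})=\mathrm{GL}((\mathbb{C}^2)^{\otimes n})$ be the $n$-qubit Pauli group. Then $$\mathbb{E}[\mathrm{Exp}_\sigma(X_{P_n}h_1)]=\sum_{\tau=(\tau_1,\ldots,\tau_s)}c_\tau\, m_\tau,\qquad c_\tau=\begin{cases}\frac{A}{4^n}&\text{if } |\tau|\equiv0 \bmod 4 \text{ and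 some }\tau_r\text{ is odd}\\[2pt] B+\frac{A-B}{4^n}&\text{if }|\tau|\equiv 0\bmod 4\text{ and all }\tau_r\text{ are even}\\[2pt] 0&\text{if }|\tau|\not\equiv0\bmod 4,\end{cases}$$ where $$A=\prod_{r=1}^s\binom{2^n+\tau_r-1}{\tau_r},\qquad B=\prod_{r=1}^s\binom{2^{n-1}+\frac{\tau_r}{2}-1}{\frac{\tau_r}{2}}.$$ Equivalently, the coefficient of $m_\tau$ in $\mathbb{E}[\mathrm{Exp}_\sigma(X_{P_n}h_1)]$ is zero if $4\nmid|\tau|$, and otherwise agrees with the coefficient of $m_\tau$ in $$\frac1{4^n}\mathrm{Exp}_\sigma(2^np_1)+\Bigl(1-\frac1{4^n}\Bigr)\mathrm{Exp}_\sigma(2^{n-1}p_2).$$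
   Context: Partitions: a partition is a non-increasing sequence $\tau=(\tau_1,\tau_2,\ldots)$ of non-negative integers that is eventually zero; $|\tau|=\sum_i\tau_i$. Writing $\tau=(\tau_1,\dots,\tau_s)$ means the remaining entries are zero. Symmetric functions: $\Lambda=\varprojlim_n\mathbb{Z}[t_1,\ldots,t_n]^{\Sigma_n}$ (graded) is the ring of symmetric functions in $t_1,t_2,\ldots$; $h_i$ and $p_i$ are the $i$th complete and power sum symmetric functions; $h_\tau=h_{\tau_1}h_{\tau_2}\cdots$; $m_\tau$ is the monomial symmetric function, the sum of all distinct permutations of $t_1^{\tau_1}t_2^{\tau_2}\cdots$. For a ring $C$, $\Lambda_C^\wedge$ is the ring of symmetric power series in $t_1,t_2,\ldots$ over $C$, i.e. formal, possibly infinite, sums $\sum_\tau a_\tau m_\tau$ with $a_\tau\in C$. Plethystic exponential: for a symmetric power series $F$ with integer (or rational) coefficients and zero constant term, $p_i\circ F:=F(t_1^i,t_2^i,\ldots)$; $f\mapsto f\circ F$ extends to a ring homomorphism on $\Lambda_{\mathbb{Q}}=\mathbb{Q}[p_1,p_2,\ldots]$; and $\mathrm{Exp}_\sigma(F):=\sum_{k\ge0}h_k\circ F=\prod_{i\ge1}\exp\left(\frac1i\,p_i\circ F\right)$. $\sigma$-moment generating function of a finite matrix group: let $G\le\mathrm{GL}_N(\mathbb{C})$ be finite. $\mathbb{Z}[\mathbb{C}]$ is the ring of finite formal sums $\sum a_j[z_j]$ ($a_j\in\mathbb{Z}$, $z_j\in\mathbb{C}$) with $[z][w]=[zw]$, with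 $\lambda$-ring structure determined by $p_i\circ\sum a_j[z_j]=\sum a_j[z_j^i]$; functions $G\to\mathbb{Z}[\mathbb{C}]$ form a $\lambda$-ring pointwise, with expectation $\mathbb{E}[f]=\frac1{\#G}\sum_{g\in G}f(g)_1$, where $(\sum a_j[z_j])_1=\sum a_jz_j\in\mathbb{C}$. $X_G$ is the function sending $g$ to the formal sum of its eigenvalues with multiplicity. The $\sigma$-moment generating function is $\mathbb{E}[\mathrm{Exp}_\sigma(X_Gh_1)]=\sum_\tau\mathbb{E}[h_\tau\circ X_G]\,m_\tau\in\Lambda_{\mathbb{C}}^\wedge$; explicitly, $\mathbb{E}[h_\tau\circ X_G]$ is the average over $g\in G$ of the value of $h_\tau$ at the eigenvalues of $g$ (with multiplicity). Pauli group: for $n \geq 1$, the $n$-qubit Pauli group $P_n\le\mathrm{GL}((\mathbb{C}^2)^{\otimes n})$ consists of the matrices $u(M_1\otimes\cdots\otimes M_n)$ with $u\in\{\pm1,\pm i\}$ and each $M_j\in\{I,X,Y,Z\}$, where $I=\begin{bmatrix}1&0\\0&1\end{bmatrix}$, $X=\begin{bmatrix}0&1\\1&0\end{bmatrix}$, $Y=\begin{bmatrix}0&i\\-i&0\end{bmatrix}$, $Z=\begin{bmatrix}1&0\\0&-1\end{bmatrix}$. *)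

theory Defs
  imports
    "Jordan_Normal_Form.Char_Poly"
    "HOL-Library.Poly_Mapping"
    "HOL-Library.Function_Algebras"
begin

section \<open>Power series in countably many variables\<close>

text \<open>
  Exponent vectors are finitely supported functions \<^typ>\<open>nat \<Rightarrow>\<^sub>0 nat\<close>; the variables
  \<open>t\<^sub>1, t\<^sub>2, \<dots>\<close> are numbered from \<open>0\<close> here.  A power series is an arbitrary family of
  coefficients, so infinitely many monomials of the same degree may occur.
\<close>

typedef 'a mps = "UNIV :: ((nat \<Rightarrow>\<^sub>0 nat) \<Rightarrow> 'a) set"
  morphisms mcoeff MPS ..

setup_lifting type_definition_mps

lemma mcoeff_MPS [simp]: "mcoeff (MPS f) = f"
  by (simp add: MPS_inverse)

lemma mps_eqI: "(\<And>e. mcoeff F e = mcoeff G e) \<Longrightarrow> F = G"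
  by (simp add: mcoeff_inject[symmetric] fun_eq_iff)

lemma finite_splittings: "finite {(a, b). a + b = (e :: nat \<Rightarrow>\<^sub>0 nat)}"
proof (rule inj_on_finite)
  let ?r = "\<lambda>a. restrict (Poly_Mapping.lookup a) (Poly_Mapping.keys e)"
  let ?P = "Pi\<^sub>E (Poly_Mapping.keys e) (\<lambda>x. {..Poly_Mapping.lookup e x})"
  show "finite (?P \<times> ?P)"
    by (intro finite_cartesian_product finite_PiE) auto
  show "(\<lambda>(a, b). (?r a, ?r b)) ` {(a, b). a + b = e} \<subseteq> ?P \<times> ?P"
    by (auto simp: lookup_add PiE_iff restrict_def extensional_def)
  have eq: "a = a'" if r: "?r a = ?r a'" and s: "a + b = e" "a' + b' = e" for a b a' b'
  proof (rule poly_mapping_eqI)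
    fix x
    show "Poly_Mapping.lookup a x = Poly_Mapping.lookup a' x"
    proof (cases "x \<in> Poly_Mapping.keys e")
      case True
      then show ?thesis using fun_cong[OF r, of x] by (simp only: restrict_def if_True)
    next
      case False
      then have "Poly_Mapping.lookup e x = 0"
        by (simp add: in_keys_iff)
      moreover have
        "Poly_Mapping.lookup e x = Poly_Mapping.lookup a x + Poly_Mapping.lookup b x"
        "Poly_Mapping.lookup e x = Poly_Mapping.lookup a' x + Poly_Mapping.lookup b' x"
        using lookup_add[of a b] lookup_add[of a' b'] by (simp_all only: s)
      ultimately show ?thesis by simp
    qed
  qed
  show "inj_on (\<lambda>(a, b). (?r a, ?r b)) {(a, b). a + b = e}"
  proof (rule inj_onI)
    fix p q
    assume p: "p \<in> {(a, b). a + b = e}" and q: "q \<in> {(a, b). a + b = e}"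
      and r: "(\<lambda>(a, b). (?r a, ?r b)) p = (\<lambda>(a, b). (?r a, ?r b)) q"
    from p q r have r': "?r (fst p) = ?r (fst q)" "?r (snd p) = ?r (snd q)"
      and s: "fst p + snd p = e" "fst q + snd q = e"
      by (simp_all only: case_prod_unfold prod.inject mem_Collect_eq)
    have "snd p + fst p = e" "snd q + fst q = e"
      using s by (simp_all only: add.commute)
    then show "p = q"
      using eq[OF r'(1) s] eq[OF r'(2)] by (intro prod_eqI)
  qed
qed

instantiation mps :: (comm_ring_1) comm_ring_1
begin

lift_definition zero_mps :: "'a mps" is "\<lambda>_. 0" .
lift_definition one_mps :: "'a mps" is "\<lambda>e. if e = 0 then 1 else 0" .
lift_definition plus_mps :: "'a mps \<Rightarrow> 'a mps \<Rightarrow> 'a mps" is "\<lambda>f g e. f e + g e" .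
lift_definition minus_mps :: "'a mps \<Rightarrow> 'a mps \<Rightarrow> 'a mps" is "\<lambda>f g e. f e - g e" .
lift_definition uminus_mps :: "'a mps \<Rightarrow> 'a mps" is "\<lambda>f e. - f e" .
lift_definition times_mps :: "'a mps \<Rightarrow> 'a mps \<Rightarrow> 'a mps"
  is "\<lambda>f g e. \<Sum>(a, b) | a + b = e. f a * g b" .

instance
proof
  fix F G H :: "'a mps"
  show "F * G * H = F * (G * H)"
  proof (rule mps_eqI)
    fix e
    define S where "S = (\<lambda>e. {(a, b). a + b = (e :: nat \<Rightarrow>\<^sub>0 nat)})"
    have fin: "finite (S x)" for x
      unfolding S_def by (rule finite_splittings)
    have times: "mcoeff (P * Q) x = (\<Sum>p\<in>S x. mcoeff P (fst p) * mcoeff Q (snd p))"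
      for P Q :: "'a mps" and x
      by (simp add: times_mps.rep_eq S_def case_prod_unfold)
    have "mcoeff (F * G * H) e = (\<Sum>p\<in>S e. \<Sum>q\<in>S (fst p).
        mcoeff F (fst q) * mcoeff G (snd q) * mcoeff H (snd p))"
      by (simp add: times sum_distrib_right)
    also have "\<dots> = (\<Sum>(p, q)\<in>Sigma (S e) (\<lambda>p. S (fst p)).
        mcoeff F (fst q) * mcoeff G (snd q) * mcoeff H (snd p))"
      by (rule sum.Sigma) (auto simp: fin)
    also have "\<dots> = (\<Sum>(p, q)\<in>Sigma (S e) (\<lambda>p. S (snd p)).
        mcoeff F (fst p) * (mcoeff G (fst q) * mcoeff H (snd q)))"
      by (rule sum.reindex_bij_witness[where
            i = "\<lambda>((a, y), (b, c)). ((a + b, c), (a, b))" and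
            j = "\<lambda>((x, c), (a, b)). ((a, b + c), (b, c))"])
        (auto simp: S_def algebra_simps)
    also have "\<dots> = (\<Sum>p\<in>S e. \<Sum>q\<in>S (snd p).
        mcoeff F (fst p) * (mcoeff G (fst q) * mcoeff H (snd q)))"
      by (rule sum.Sigma[symmetric]) (auto simp: fin)
    also have "\<dots> = mcoeff (F * (G * H)) e"
      by (simp add: times sum_distrib_left)
    finally show "mcoeff (F * G * H) e = mcoeff (F * (G * H)) e" .
  qed
  show "F * G = G * F"
  proof (rule mps_eqI)
    fix e
    show "mcoeff (F * G) e = mcoeff (G * F) e"
      unfolding times_mps.rep_eq
      by (rule sum.reindex_bij_witness[where i = prod.swap and j = prod.swap])
        (auto simp: add.commute mult.commute)
  qed
  show "1 * F = F"
  proof (rule mps_eqI)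
    fix e
    have "mcoeff (1 * F) e = (\<Sum>(a, b)\<in>{(0, e)}. mcoeff 1 a * mcoeff F b)"
      unfolding times_mps.rep_eq
      by (rule sum.mono_neutral_right[OF finite_splittings]) (auto simp: one_mps.rep_eq split: if_splits)
    then show "mcoeff (1 * F) e = mcoeff F e"
      by (simp add: one_mps.rep_eq)
  qed
  show "(F + G) * H = F * H + G * H"
    by (rule mps_eqI)
      (simp add: times_mps.rep_eq plus_mps.rep_eq case_prod_unfold algebra_simps sum.distrib)
  show "(0 :: 'a mps) \<noteq> 1"
    by transfer (auto simp: fun_eq_iff)
qed (transfer; simp add: fun_eq_iff algebra_simps)+

end

definition mps_const :: "'a \<Rightarrow> 'a::comm_ring_1 mps" where
  "mps_const c = MPS (\<lambda>e. if e = 0 then c else 0)"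

definition map_mps :: "('a \<Rightarrow> 'b) \<Rightarrow> 'a mps \<Rightarrow> 'b mps" where
  "map_mps f F = MPS (\<lambda>e. f (mcoeff F e))"

definition mps_limit :: "(nat \<Rightarrow> 'a mps) \<Rightarrow> 'a mps \<Rightarrow> bool" where
  "mps_limit S L \<longleftrightarrow> (\<forall>e. \<forall>\<^sub>F N in sequentially. mcoeff (S N) e = mcoeff L e)"

definition mps_lim :: "(nat \<Rightarrow> 'a mps) \<Rightarrow> 'a mps" where
  "mps_lim S = (THE L. mps_limit S L)"

lemma mps_lim_eq:
  assumes "mps_limit S L" shows "mps_lim S = L"
  unfolding mps_lim_def
proof (rule the_equality[where P = "mps_limit S", OF assms])
  fix L' assume L': "mps_limit S L'"
  show "L' = L"
  proof (rule mps_eqI)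
    fix e
    have "\<forall>\<^sub>F N in sequentially. mcoeff (S N) e = mcoeff L e \<and> mcoeff (S N) e = mcoeff L' e"
      using assms L' unfolding mps_limit_def by (auto intro: eventually_conj)
    then obtain N where "mcoeff (S N) e = mcoeff L e" "mcoeff (S N) e = mcoeff L' e"
      by (metis (mono_tags, lifting) eventually_happens' sequentially_bot)
    then show "mcoeff L' e = mcoeff L e" by simp
  qed
qed


section \<open>Partitions and symmetric power series\<close>

text \<open>A partition is the exponent vector \<open>\<tau>\<close> with \<open>Poly_Mapping.lookup \<tau> i\<close> the part \<open>\<tau>\<^sub>i\<^sub>+\<^sub>1\<close>.\<close>

definition is_partition :: "(nat \<Rightarrow>\<^sub>0 nat) \<Rightarrow> bool" where
  "is_partition \<tau> \<longleftrightarrow> antimono (Poly_Mapping.lookup \<tau>)"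

definition degree_of :: "(nat \<Rightarrow>\<^sub>0 nat) \<Rightarrow> nat" where
  "degree_of e = (\<Sum>i\<in>Poly_Mapping.keys e. Poly_Mapping.lookup e i)"

text \<open>The number of nonzero parts: the least \<open>s\<close> such that \<open>\<tau> = (\<tau>\<^sub>1, \<dots>, \<tau>\<^sub>s)\<close>.\<close>

definition num_parts :: "(nat \<Rightarrow>\<^sub>0 nat) \<Rightarrow> nat" where
  "num_parts \<tau> = card (Poly_Mapping.keys \<tau>)"

definition complete_sym :: "nat \<Rightarrow> 'a::comm_ring_1 mps" where
  "complete_sym k = MPS (\<lambda>e. if degree_of e = k then 1 else 0)"

definition power_sum :: "nat \<Rightarrow> 'a::comm_ring_1 mps" where
  "power_sum k = MPS (\<lambda>e. if \<exists>i. e = Poly_Mapping.single i k then 1 else 0)"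

definition monomial_sym :: "(nat \<Rightarrow>\<^sub>0 nat) \<Rightarrow> 'a::comm_ring_1 mps" where
  "monomial_sym \<tau> = MPS (\<lambda>e. if \<exists>\<pi>. bij \<pi> \<and> Poly_Mapping.lookup e = Poly_Mapping.lookup \<tau> \<circ> \<pi> then 1 else 0)"

text \<open>
  The infinite sum \<open>\<Sum>\<^sub>\<tau> a\<^sub>\<tau> m\<^sub>\<tau>\<close> over all partitions; in each coefficient only finitely many
  (in fact, exactly one) of the summands are nonzero.
\<close>

definition monomial_sum :: "((nat \<Rightarrow>\<^sub>0 nat) \<Rightarrow> 'a) \<Rightarrow> 'a::comm_ring_1 mps" where
  "monomial_sum a = MPS (\<lambda>e. \<Sum>\<tau> | is_partition \<tau> \<and> mcoeff (monomial_sym \<tau> :: 'a mps) e \<noteq> 0.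
     a \<tau> * mcoeff (monomial_sym \<tau>) e)"

lemma partition_perm_unique:
  assumes "is_partition \<tau>" "is_partition \<rho>" "bij \<pi>" "Poly_Mapping.lookup \<rho> = Poly_Mapping.lookup \<tau> \<circ> \<pi>"
  shows "\<rho> = \<tau>"
proof (rule poly_mapping_eqI)
  fix x
  have card_eq: "card {i. c \<le> Poly_Mapping.lookup \<rho> i} = card {i. c \<le> Poly_Mapping.lookup \<tau> i}" for c
  proof -
    have "{i. c \<le> Poly_Mapping.lookup \<tau> i} = \<pi> ` {i. c \<le> Poly_Mapping.lookup \<rho> i}"
      using assms(3,4) by (auto simp: image_iff) (metis bij_pointE)
    then show ?thesis
      using card_image[of \<pi> "{i. c \<le> Poly_Mapping.lookup \<rho> i}"] assms(3)
      by (metis bij_is_inj inj_on_subset subset_UNIV)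
  qed
  have key: "Poly_Mapping.lookup \<alpha> x \<le> Poly_Mapping.lookup \<beta> x"
    if p: "is_partition \<alpha>" "is_partition \<beta>"
      and c: "\<And>c. card {i. c \<le> Poly_Mapping.lookup \<alpha> i} = card {i. c \<le> Poly_Mapping.lookup \<beta> i}" for \<alpha> \<beta>
  proof (rule ccontr)
    assume "\<not> ?thesis"
    then have lt: "Poly_Mapping.lookup \<beta> x < Poly_Mapping.lookup \<alpha> x" by simp
    let ?c = "Poly_Mapping.lookup \<alpha> x"
    have "{i. ?c \<le> Poly_Mapping.lookup \<alpha> i} \<subseteq> Poly_Mapping.keys \<alpha>" using lt by (auto simp: in_keys_iff)
    then have "finite {i. ?c \<le> Poly_Mapping.lookup \<alpha> i}" by (rule finite_subset) simp
    moreover have "{..x} \<subseteq> {i. ?c \<le> Poly_Mapping.lookup \<alpha> i}"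
      using antimonoD[OF p(1)[unfolded is_partition_def]] by blast
    ultimately have "Suc x \<le> card {i. ?c \<le> Poly_Mapping.lookup \<alpha> i}"
      by (metis card_atMost card_mono)
    moreover have "{i. ?c \<le> Poly_Mapping.lookup \<beta> i} \<subseteq> {..<x}"
    proof
      fix i assume "i \<in> {i. ?c \<le> Poly_Mapping.lookup \<beta> i}"
      then have "?c \<le> Poly_Mapping.lookup \<beta> i" by simp
      moreover have "x \<le> i \<Longrightarrow> Poly_Mapping.lookup \<beta> i \<le> Poly_Mapping.lookup \<beta> x"
        using antimonoD[OF p(2)[unfolded is_partition_def]] by blast
      ultimately show "i \<in> {..<x}" using lt by (cases "x \<le> i") auto
    qed
    then have "card {i. ?c \<le> Poly_Mapping.lookup \<beta> i} \<le> x"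
      by (metis card_lessThan card_mono finite_lessThan)
    ultimately show False using c by simp
  qed
  show "Poly_Mapping.lookup \<rho> x = Poly_Mapping.lookup \<tau> x"
    by (rule antisym; rule key) (use assms card_eq in auto)
qed

text \<open>
  The coefficient of \<open>m\<^sub>\<tau>\<close> in a symmetric power series is therefore its coefficient at the
  exponent vector \<open>\<tau>\<close>.
\<close>

lemma mcoeff_monomial_sum:
  assumes "is_partition \<tau>"
  shows "mcoeff (monomial_sum a) \<tau> = a \<tau>"
proof -
  have "mcoeff (monomial_sym \<rho> :: 'a mps) \<tau> \<noteq> 0 \<longleftrightarrow> \<rho> = \<tau>" if "is_partition \<rho>" for \<rho>
    using partition_perm_unique[OF that assms] bij_id
    by (auto simp: monomial_sym_def intro: exI[of _ id])
  then have "{\<rho>. is_partition \<rho> \<and> mcoeff (monomial_sym \<rho> :: 'a mps) \<tau> \<noteq> 0} = {\<tau>}"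
    using assms by auto
  moreover have "mcoeff (monomial_sym \<tau> :: 'a mps) \<tau> = 1"
    using bij_id by (auto simp: monomial_sym_def intro: exI[of _ id])
  ultimately show ?thesis by (simp add: monomial_sum_def)
qed


section \<open>Coefficient rings with Adams operations\<close>

text \<open>
  Over a \<open>\<rat>\<close>-algebra a \<open>\<lambda>\<close>-ring structure is the same as a family of commuting ring
  endomorphisms \<open>x \<mapsto> p\<^sub>i \<circ> x\<close>, the Adams operations.
\<close>

class rat_lambda_ring = comm_ring_1 +
  fixes rat_embed :: "rat \<Rightarrow> 'a"
    and adams :: "nat \<Rightarrow> 'a \<Rightarrow> 'a"
  assumes rat_embed_1: "rat_embed 1 = 1"
    and rat_embed_add: "rat_embed (p + q) = rat_embed p + rat_embed q"
    and rat_embed_mult: "rat_embed (p * q) = rat_embed p * rat_embed q"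
    and adams_one: "adams i 1 = 1"
    and adams_add: "adams i (x + y) = adams i x + adams i y"
    and adams_mult: "adams i (x * y) = adams i x * adams i y"
    and adams_1: "adams 1 x = x"
    and adams_adams: "adams i (adams j x) = adams (i * j) x"

lemma adams_zero: "adams i 0 = (0 :: 'a::rat_lambda_ring)"
  using adams_add[of i 0 "0 :: 'a"] by simp

instantiation rat :: rat_lambda_ring
begin
definition "rat_embed_rat = (\<lambda>q :: rat. q)"
definition "adams_rat = (\<lambda>(i :: nat) (q :: rat). q)"
instance by standard (simp_all add: rat_embed_rat_def adams_rat_def)
end

instantiation "fun" :: (type, rat_lambda_ring) rat_lambda_ring
begin
definition rat_embed_fun :: "rat \<Rightarrow> 'a \<Rightarrow> 'b" where "rat_embed_fun q = (\<lambda>_. rat_embed q)"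
definition adams_fun :: "nat \<Rightarrow> ('a \<Rightarrow> 'b) \<Rightarrow> 'a \<Rightarrow> 'b"
  where "adams_fun i f = (\<lambda>x. adams i (f x))"
instance
  by standard (simp_all add: fun_eq_iff rat_embed_fun_def adams_fun_def rat_embed_1 rat_embed_add
      rat_embed_mult adams_one adams_add adams_mult adams_1[unfolded One_nat_def] adams_adams)
end

definition nat_multiple :: "nat \<Rightarrow> 'm \<Rightarrow> 'm::comm_monoid_add" where
  "nat_multiple i k = (\<Sum>_<i. k)"

lemma nat_multiple_simps [simp]:
  "nat_multiple 0 k = 0" "nat_multiple (Suc i) k = k + nat_multiple i k" "nat_multiple i 0 = 0"
  by (simp_all add: nat_multiple_def add.commute)

lemma nat_multiple_distrib: "nat_multiple i (k + l) = nat_multiple i k + nat_multiple i l"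
  by (simp add: nat_multiple_def sum.distrib)

lemma nat_multiple_add: "nat_multiple (i + j) k = nat_multiple i k + nat_multiple j k"
  by (induction i) (simp_all add: add.assoc)

lemma nat_multiple_mult: "nat_multiple i (nat_multiple j k) = nat_multiple (i * j) k"
  by (induction i) (simp_all add: nat_multiple_add)

text \<open>
  The monoid ring \<open>A[M]\<close> of a commutative monoid \<open>M\<close> (written additively, as in
  \<^theory>\<open>HOL-Library.Poly_Mapping\<close>) is a \<open>\<lambda>\<close>-ring with
  \<open>p\<^sub>i \<circ> \<Sum> a\<^sub>k [k] = \<Sum> (p\<^sub>i \<circ> a\<^sub>k) [k + \<dots> + k]\<close>.
\<close>

instantiation poly_mapping :: (comm_monoid_add, rat_lambda_ring) rat_lambda_ring
begin

definition rat_embed_poly_mapping :: "rat \<Rightarrow> 'a \<Rightarrow>\<^sub>0 'b" where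
  "rat_embed_poly_mapping q = Poly_Mapping.single 0 (rat_embed q)"

definition adams_poly_mapping :: "nat \<Rightarrow> ('a \<Rightarrow>\<^sub>0 'b) \<Rightarrow> 'a \<Rightarrow>\<^sub>0 'b" where
  "adams_poly_mapping i f =
     (\<Sum>k\<in>Poly_Mapping.keys f. Poly_Mapping.single (nat_multiple i k) (adams i (Poly_Mapping.lookup f k)))"

instance
proof
  let ?S = "Poly_Mapping.single :: 'a \<Rightarrow> 'b \<Rightarrow> 'a \<Rightarrow>\<^sub>0 'b"
  fix p q :: rat
  show "rat_embed 1 = (1 :: 'a \<Rightarrow>\<^sub>0 'b)"
    by (simp add: rat_embed_poly_mapping_def rat_embed_1)
  show "(rat_embed (p + q) :: 'a \<Rightarrow>\<^sub>0 'b) = rat_embed p + rat_embed q"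
    by (simp add: rat_embed_poly_mapping_def rat_embed_add single_add)
  show "(rat_embed (p * q) :: 'a \<Rightarrow>\<^sub>0 'b) = rat_embed p * rat_embed q"
    by (simp add: rat_embed_poly_mapping_def rat_embed_mult mult_single)
  have sup: "adams i f = (\<Sum>k\<in>S. ?S (nat_multiple i k) (adams i (Poly_Mapping.lookup f k)))"
    if "finite S" "Poly_Mapping.keys f \<subseteq> S" for i f S
    unfolding adams_poly_mapping_def
    by (rule sum.mono_neutral_left) (use that in \<open>auto simp: in_keys_iff adams_zero\<close>)
  have single: "adams i (?S k a) = ?S (nat_multiple i k) (adams i a)" for i k a
    using sup[of "{k}" "?S k a" i] by simp
  have add: "adams i (f + g) = adams i f + adams i g" for i and f g :: "'a \<Rightarrow>\<^sub>0 'b"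
  proof -
    let ?U = "Poly_Mapping.keys f \<union> Poly_Mapping.keys g"
    have "adams i (f + g) =
        (\<Sum>k\<in>?U. ?S (nat_multiple i k) (adams i (Poly_Mapping.lookup (f + g) k)))"
      by (rule sup) (simp_all add: Poly_Mapping.keys_add)
    also have "\<dots> = (\<Sum>k\<in>?U. ?S (nat_multiple i k) (adams i (Poly_Mapping.lookup f k)))
        + (\<Sum>k\<in>?U. ?S (nat_multiple i k) (adams i (Poly_Mapping.lookup g k)))"
      by (simp only: lookup_add adams_add single_add sum.distrib)
    also have "\<dots> = adams i f + adams i g"
      by (intro arg_cong2[of _ _ _ _ "(+)"] sup[symmetric]) simp_all
    finally show ?thesis .
  qed
  have zero: "adams i (0 :: 'a \<Rightarrow>\<^sub>0 'b) = 0" for i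
    by (simp add: adams_poly_mapping_def)
  have sum: "adams i (sum h S) = (\<Sum>x\<in>S. adams i (h x))"
    for i S and h :: "'a \<Rightarrow> 'a \<Rightarrow>\<^sub>0 'b"
    by (induction S rule: infinite_finite_induct) (simp_all add: zero add)
  have expand: "f = (\<Sum>k\<in>Poly_Mapping.keys f. ?S k (Poly_Mapping.lookup f k))" for f
    by (rule poly_mapping_eqI) (simp add: lookup_sum lookup_single when_def in_keys_iff)
  fix i j :: nat and x y :: "'a \<Rightarrow>\<^sub>0 'b"
  show "adams i (1 :: 'a \<Rightarrow>\<^sub>0 'b) = 1"
    using single[of i 0 1] by (simp add: adams_one)
  show "adams i (x + y) = adams i x + adams i y" by (rule add)
  show "adams i (x * y) = adams i x * adams i y"
  proof -
    have "x * y = (\<Sum>k\<in>Poly_Mapping.keys x. \<Sum>l\<in>Poly_Mapping.keys y.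
        ?S k (Poly_Mapping.lookup x k) * ?S l (Poly_Mapping.lookup y l))"
      using arg_cong2[OF expand[of x] expand[of y], of "(*)"] by (simp only: sum_product)
    also have "adams i \<dots> = (\<Sum>k\<in>Poly_Mapping.keys x. \<Sum>l\<in>Poly_Mapping.keys y.
        ?S (nat_multiple i k) (adams i (Poly_Mapping.lookup x k)) *
        ?S (nat_multiple i l) (adams i (Poly_Mapping.lookup y l)))"
      by (simp only: sum single mult_single nat_multiple_distrib adams_mult)
    also have "\<dots> = adams i x * adams i y"
      by (simp only: adams_poly_mapping_def sum_product)
    finally show ?thesis .
  qed
  show "adams 1 x = x"
    using expand[of x, symmetric]
    by (simp add: adams_poly_mapping_def adams_1[unfolded One_nat_def])
  show "adams i (adams j x) = adams (i * j) x"
    unfolding adams_poly_mapping_def[of j x] adams_poly_mapping_def[of "i * j" x]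
    by (simp add: sum single nat_multiple_mult adams_adams)
qed

end


section \<open>The plethystic exponential\<close>

definition mps_exp :: "'a::rat_lambda_ring mps \<Rightarrow> 'a mps" where
  "mps_exp F = mps_lim (\<lambda>N. \<Sum>k\<le>N. mps_const (rat_embed (1 / fact k)) * F ^ k)"

text \<open>
  \<open>p\<^sub>i \<circ> F\<close> for \<open>i \<ge> 1\<close>: apply the Adams operation to the coefficients and replace every
  variable by its \<open>i\<close>-th power.  For rational coefficients this is \<open>F(t\<^sub>1\<^sup>i, t\<^sub>2\<^sup>i, \<dots>)\<close>.
\<close>

definition power_sum_pleth :: "nat \<Rightarrow> 'a::rat_lambda_ring mps \<Rightarrow> 'a mps" where
  "power_sum_pleth i F = MPS (\<lambda>e. if \<forall>x. i dvd Poly_Mapping.lookup e x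
     then adams i (mcoeff F (Poly_Mapping.map (\<lambda>k. k div i) e)) else 0)"

text \<open>For \<open>F\<close> with zero constant term, \<open>Exp\<^sub>\<sigma>(F) = \<Prod>\<^sub>i\<^sub>\<ge>\<^sub>1 exp((p\<^sub>i \<circ> F) / i)\<close>.\<close>

definition Exp_sigma :: "'a::rat_lambda_ring mps \<Rightarrow> 'a mps" where
  "Exp_sigma F =
     mps_lim (\<lambda>N. \<Prod>i=1..N. mps_exp (mps_const (rat_embed (1 / of_nat i)) * power_sum_pleth i F))"


section \<open>Moment generating functions of finite matrix groups\<close>

text \<open>
  The multiplicative monoid of \<open>\<complex>\<close> is written additively, because \<open>\<Rightarrow>\<^sub>0\<close> takes the monoid
  operation to be addition.  Then \<open>mult_complex \<Rightarrow>\<^sub>0 rat\<close> is the ring \<open>\<rat>[\<complex>]\<close> of formal sums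
  \<open>\<Sum> a\<^sub>j [z\<^sub>j]\<close> with \<open>[z][w] = [zw]\<close> and \<open>p\<^sub>i \<circ> [z] = [z\<^sup>i]\<close>.  Rational rather than integer
  coefficients are needed for the product formula for \<open>Exp\<^sub>\<sigma>\<close>.
\<close>

datatype mult_complex = Mult_Complex (complex_val: complex)

instantiation mult_complex :: comm_monoid_add
begin
definition "zero_mult_complex = Mult_Complex 1"
definition "plus_mult_complex z w = Mult_Complex (complex_val z * complex_val w)"
instance by standard (simp_all add: zero_mult_complex_def plus_mult_complex_def)
end

type_synonym formal_sum = "mult_complex \<Rightarrow>\<^sub>0 rat"

definition sum_value :: "formal_sum \<Rightarrow> complex" where
  "sum_value f = (\<Sum>k\<in>Poly_Mapping.keys f. of_rat (Poly_Mapping.lookup f k) * complex_val k)"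

definition expectation :: "complex mat set \<Rightarrow> (complex mat \<Rightarrow> formal_sum) \<Rightarrow> complex" where
  "expectation G f = (\<Sum>g\<in>G. sum_value (f g)) / of_nat (card G)"

definition eigenvalue_sum :: "complex mat \<Rightarrow> formal_sum" where
  "eigenvalue_sum A = (\<Sum>z\<in>#proots (char_poly A). Poly_Mapping.single (Mult_Complex z) 1)"

text \<open>
  Functions on \<open>G\<close> are represented by functions on all matrices, with the ring and \<open>\<lambda>\<close>-ring
  operations pointwise; \<^const>\<open>expectation\<close> only depends on their values on \<open>G\<close>.
\<close>

definition sigma_mgf :: "complex mat set \<Rightarrow> complex mps" where
  "sigma_mgf G = map_mps (expectation G) (Exp_sigma (mps_const eigenvalue_sum * complete_sym 1))"


section \<open>The groups\<close>

definition cyclic_matrices :: "nat \<Rightarrow> complex mat set" where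
  "cyclic_matrices n =
     (\<lambda>j. mat_of_rows_list 1 [[exp (2 * of_real pi * \<i> * of_nat j / of_nat n)]]) ` {..<n}"

definition rotation :: "real \<Rightarrow> complex mat" where
  "rotation \<theta> = map_mat of_real (mat_of_rows_list 2 [[cos \<theta>, - sin \<theta>], [sin \<theta>, cos \<theta>]])"

text \<open>The reflection in the line through the origin at angle \<open>\<theta>/2\<close>.\<close>

definition reflection :: "real \<Rightarrow> complex mat" where
  "reflection \<theta> = map_mat of_real (mat_of_rows_list 2 [[cos \<theta>, sin \<theta>], [sin \<theta>, - cos \<theta>]])"

definition dihedral_matrices :: "nat \<Rightarrow> complex mat set" where
  "dihedral_matrices n =
     (\<lambda>j. rotation (2 * pi * real j / real n)) ` {..<n} \<union>
     (\<lambda>j. reflection (2 * pi * real j / real n)) ` {..<n}"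

definition kronecker :: "'a::semiring_1 mat \<Rightarrow> 'a mat \<Rightarrow> 'a mat" where
  "kronecker A B = mat (dim_row A * dim_row B) (dim_col A * dim_col B)
     (\<lambda>(i, j). A $$ (i div dim_row B, j div dim_col B) * B $$ (i mod dim_row B, j mod dim_col B))"

definition pauli_I :: "complex mat" where "pauli_I = mat_of_rows_list 2 [[1, 0], [0, 1]]"
definition pauli_X :: "complex mat" where "pauli_X = mat_of_rows_list 2 [[0, 1], [1, 0]]"
definition pauli_Y :: "complex mat" where "pauli_Y = mat_of_rows_list 2 [[0, \<i>], [- \<i>, 0]]"
definition pauli_Z :: "complex mat" where "pauli_Z = mat_of_rows_list 2 [[1, 0], [0, -1]]"

definition pauli_group :: "nat \<Rightarrow> complex mat set" where
  "pauli_group n = {u \<cdot>\<^sub>m foldr kronecker Ms (1\<^sub>m 1) | u Ms.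
     u \<in> {1, -1, \<i>, - \<i>} \<and> length Ms = n \<and> set Ms \<subseteq> {pauli_I, pauli_X, pauli_Y, pauli_Z}}"


section \<open>The coefficients\<close>

definition dihedral_tuples :: "nat \<Rightarrow> (nat \<Rightarrow>\<^sub>0 nat) \<Rightarrow> int list set" where
  "dihedral_tuples n \<tau> = {rs. length rs = num_parts \<tau> \<and>
     (\<forall>i<num_parts \<tau>. 0 \<le> rs ! i \<and> rs ! i \<le> int (Poly_Mapping.lookup \<tau> i)) \<and>
     int n dvd (int (degree_of \<tau>) - 2 * sum_list rs)}"

definition pauli_A :: "nat \<Rightarrow> (nat \<Rightarrow>\<^sub>0 nat) \<Rightarrow> nat" where
  "pauli_A n \<tau> = (\<Prod>r<num_parts \<tau>. (2 ^ n + Poly_Mapping.lookup \<tau> r - 1) choose Poly_Mapping.lookup \<tau> r)"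

definition pauli_B :: "nat \<Rightarrow> (nat \<Rightarrow>\<^sub>0 nat) \<Rightarrow> nat" where
  "pauli_B n \<tau> =
     (\<Prod>r<num_parts \<tau>. (2 ^ (n - 1) + Poly_Mapping.lookup \<tau> r div 2 - 1) choose (Poly_Mapping.lookup \<tau> r div 2))"

definition pauli_coeff :: "nat \<Rightarrow> (nat \<Rightarrow>\<^sub>0 nat) \<Rightarrow> complex" where
  "pauli_coeff n \<tau> =
     (if \<not> 4 dvd degree_of \<tau> then 0
      else if \<exists>r. odd (Poly_Mapping.lookup \<tau> r) then of_nat (pauli_A n \<tau>) / 4 ^ n
      else of_nat (pauli_B n \<tau>) + (of_nat (pauli_A n \<tau>) - of_nat (pauli_B n \<tau>)) / 4 ^ n)"

end

theory Submission
  imports Defs "Jordan_Normal_Form.Schur_Decomposition"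
    "HOL-Computational_Algebra.Formal_Power_Series"
begin

text \<open>
  The Euler operator \<open>t\<^sub>x \<partial>/\<partial>t\<^sub>x\<close> turns \<open>Exp\<^sub>\<sigma>(X p\<^sub>k) = \<Prod>\<^sub>i exp((p\<^sub>i \<circ> X) p\<^sub>i\<^sub>k / i)\<close> into Newton's
  recursion \<open>m h\<^sub>m = \<Sum>\<^sub>i p\<^sub>i h\<^sub>m\<^sub>-\<^sub>i\<close> in each variable separately, so its coefficient at \<open>\<tau>\<close> is a product
  over the parts of \<open>\<tau>\<close> of numbers determined by that recursion.  For a matrix \<open>g\<close> the \<open>i\<close>th power
  sum of the eigenvalues is the trace of \<open>g\<^sup>i\<close>.  These traces are explicit in all three groups:
  powers of rotations are rotations, while reflections and non-scalar Pauli matrices have scalar square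
  and trace \<open>0\<close>.  Averaging over roots of unity gives the divisibility conditions.
\<close>

section \<open>Euler operators and exponentials of power series\<close>

text \<open>The plethystic exponential has coefficients in a ring of functions with values in Q[C],
  which has zero divisors and where eigenvalues are only formal symbols. Newton's recursion needs
  division by positive integers and nothing else, so it is solved there once
  (\<open>complete_of\<close>) and then carried to the complex numbers by evaluating at a matrix and
  applying \<open>sum_value\<close>, a ring homomorphism. Averaging over the group is not
  multiplicative and is therefore left to the very end.

  With infinitely many variables the power sums are infinite sums. The Euler derivative in one
  variable cuts \<open>p_m\<close> down to the single monomial \<open>m t_x^m\<close>, so the
  resulting recursion lowers one exponent and leaves the others alone; this is why a product over
  the exponents solves it.

  Over the complex numbers the recursion has only one solution. The complete symmetric functions of
  a group element are thus found by exhibiting a sequence and checking it against traces of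
  powers.\<close>

lemma mcoeff_times: "mcoeff (F * G) e = (\<Sum>(a, b) | a + b = e. mcoeff F a * mcoeff G b)"
  by (simp add: times_mps.rep_eq)

lemma mcoeff_sum: "mcoeff (sum f A) e = (\<Sum>i\<in>A. mcoeff (f i) e)"
  by (induction A rule: infinite_finite_induct) (simp_all add: zero_mps.rep_eq plus_mps.rep_eq)

lemma mcoeff_mps_const: "mcoeff (mps_const c) e = (if e = 0 then c else 0)"
  by (simp add: mps_const_def)

lemma mcoeff_const_times [simp]: "mcoeff (mps_const c * F) e = c * mcoeff F e"
proof -
  have "mcoeff (mps_const c * F) e = (\<Sum>(a, b)\<in>{(0, e)}. mcoeff (mps_const c) a * mcoeff F b)"
    unfolding mcoeff_times
    by (rule sum.mono_neutral_right[OF finite_splittings])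
      (auto simp: mcoeff_mps_const split: if_splits)
  then show ?thesis
    by (simp add: mcoeff_mps_const)
qed

lemma keys_add_nat: "Poly_Mapping.keys (a + b) = Poly_Mapping.keys a \<union> Poly_Mapping.keys (b :: 'a \<Rightarrow>\<^sub>0 nat)"
  by (auto simp: in_keys_iff lookup_add)

lemma degree_of_eq_sum:
  assumes "finite S" "Poly_Mapping.keys e \<subseteq> S"
  shows "degree_of e = (\<Sum>i\<in>S. Poly_Mapping.lookup e i)"
  unfolding degree_of_def by (rule sum.mono_neutral_left) (use assms in \<open>auto simp: in_keys_iff\<close>)

lemma degree_of_add: "degree_of (a + b) = degree_of a + degree_of b"
proof -
  let ?S = "Poly_Mapping.keys a \<union> Poly_Mapping.keys b"
  have "degree_of (a + b) = (\<Sum>i\<in>?S. Poly_Mapping.lookup (a + b) i)"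
    by (rule degree_of_eq_sum) (auto simp: keys_add_nat)
  also have "\<dots> = (\<Sum>i\<in>?S. Poly_Mapping.lookup a i) + (\<Sum>i\<in>?S. Poly_Mapping.lookup b i)"
    by (simp add: lookup_add sum.distrib)
  also have "(\<Sum>i\<in>?S. Poly_Mapping.lookup a i) = degree_of a"
    by (rule degree_of_eq_sum[symmetric]) auto
  also have "(\<Sum>i\<in>?S. Poly_Mapping.lookup b i) = degree_of b"
    by (rule degree_of_eq_sum[symmetric]) auto
  finally show ?thesis .
qed

lemma lookup_le_degree_of: "Poly_Mapping.lookup e x \<le> degree_of e"
  by (cases "x \<in> Poly_Mapping.keys e") (auto simp: degree_of_def in_keys_iff intro: member_le_sum)

lemma degree_of_0 [simp]: "degree_of 0 = 0"
  by (simp add: degree_of_def)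

lemma degree_of_single [simp]: "degree_of (Poly_Mapping.single x k) = k"
  by (cases "k = 0") (simp_all add: degree_of_def)

lemma degree_of_eq_0_iff: "degree_of e = 0 \<longleftrightarrow> e = 0"
  by (auto simp: degree_of_def in_keys_iff intro!: poly_mapping_eqI)

definition euler :: "nat \<Rightarrow> 'a::comm_ring_1 mps \<Rightarrow> 'a mps" where
  "euler x F = MPS (\<lambda>e. of_nat (Poly_Mapping.lookup e x) * mcoeff F e)"

lemma mcoeff_euler: "mcoeff (euler x F) e = of_nat (Poly_Mapping.lookup e x) * mcoeff F e"
  by (simp add: euler_def)

text \<open>The Leibniz rule, because the exponent of a product of monomials is the sum of the
  exponents.\<close>

lemma euler_mult: "euler x (F * G) = euler x F * G + F * euler x G"
proof (rule mps_eqI)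
  fix e
  have "mcoeff (euler x (F * G)) e
      = (\<Sum>(a, b) | a + b = e. of_nat (Poly_Mapping.lookup (a + b) x) * (mcoeff F a * mcoeff G b))"
    by (simp add: mcoeff_euler mcoeff_times sum_distrib_left case_prod_unfold)
  also have "\<dots> = mcoeff (euler x F * G + F * euler x G) e"
    unfolding plus_mps.rep_eq mcoeff_times mcoeff_euler
    by (simp add: lookup_add algebra_simps sum.distrib case_prod_unfold)
  finally show "mcoeff (euler x (F * G)) e = mcoeff (euler x F * G + F * euler x G) e" .
qed

lemma euler_const_times: "euler x (mps_const c * F) = mps_const c * euler x F"
  by (rule mps_eqI) (simp only: mcoeff_euler mcoeff_const_times mult.left_commute)

lemma euler_one [simp]: "euler x 1 = 0"
  by (rule mps_eqI) (auto simp: mcoeff_euler one_mps.rep_eq zero_mps.rep_eq)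

lemma euler_sum: "euler x (sum f A) = (\<Sum>i\<in>A. euler x (f i))"
  by (rule mps_eqI) (simp add: mcoeff_euler mcoeff_sum sum_distrib_left)

lemma mps_const_mult: "mps_const (a * b) = mps_const a * mps_const b"
  by (rule mps_eqI) (simp add: mcoeff_mps_const)

lemma mps_const_1: "mps_const 1 = 1"
  by (rule mps_eqI) (simp add: mcoeff_mps_const one_mps.rep_eq)

lemma mps_const_of_nat: "mps_const (of_nat n) = of_nat n"
proof (induction n)
  case 0
  show ?case by (rule mps_eqI) (simp add: mcoeff_mps_const zero_mps.rep_eq)
next
  case (Suc n)
  have "mps_const (of_nat (Suc n) :: 'a) = mps_const 1 + mps_const (of_nat n)"
    by (rule mps_eqI) (simp add: mcoeff_mps_const plus_mps.rep_eq)
  then show ?case by (simp add: Suc mps_const_1)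
qed

lemma euler_power: "euler x (F ^ Suc k) = of_nat (Suc k) * F ^ k * euler x F"
  by (induction k) (simp_all add: euler_mult algebra_simps)

text \<open>Each factor without constant term raises the degree by at least one. Hence only finitely
  many terms of the exponential series reach a given coefficient.\<close>

lemma mcoeff_power_eq_0:
  assumes "mcoeff F 0 = 0" "degree_of e < k"
  shows "mcoeff (F ^ k) e = 0"
  using assms(2)
proof (induction k arbitrary: e)
  case (Suc k)
  have "mcoeff F a * mcoeff (F ^ k) b = 0" if "a + b = e" for a b
  proof (cases "a = 0")
    case False
    then have "degree_of b < k"
      using Suc.prems degree_of_add[of a b] degree_of_eq_0_iff[of a] unfolding that by linarith
    then show ?thesis by (simp add: Suc.IH)
  qed (simp add: assms)
  then show ?case by (auto simp: mcoeff_times intro!: sum.neutral)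
qed simp

text \<open>No splitting of \<open>e\<close> has a part of larger degree. This permits replacing a
  limit by a truncation inside a product.\<close>

lemma mcoeff_times_cong:
  assumes "\<And>b. degree_of b \<le> degree_of e \<Longrightarrow> mcoeff G b = mcoeff G' b"
  shows "mcoeff (F * G) e = mcoeff (F * G') e"
  unfolding mcoeff_times
proof (rule sum.cong[OF refl], clarify)
  fix a b assume "e = a + b"
  then have "mcoeff G b = mcoeff G' b"
    by (intro assms) (simp add: degree_of_add)
  then show "mcoeff F a * mcoeff G b = mcoeff F a * mcoeff G' b"
    by simp
qed

lemma rat_embed_of_nat: "rat_embed (of_nat n) = (of_nat n :: 'a::rat_lambda_ring)"
proof (induction n)
  case 0
  show ?case using rat_embed_add[of 0 0, where 'a = 'a] by simp
qed (simp add: rat_embed_add rat_embed_1)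

lemma rat_embed_inverse_of_nat:
  assumes "n \<noteq> 0"
  shows "rat_embed (1 / of_nat n) * of_nat n = (1 :: 'a::rat_lambda_ring)"
    "of_nat n * rat_embed (1 / of_nat n) = (1 :: 'a::rat_lambda_ring)"
proof -
  have "rat_embed (1 / of_nat n) * rat_embed (of_nat n) = (1 :: 'a)"
    using assms by (simp flip: rat_embed_mult add: rat_embed_1)
  then show "rat_embed (1 / of_nat n) * of_nat n = (1 :: 'a)"
    by (simp add: rat_embed_of_nat)
  then show "of_nat n * rat_embed (1 / of_nat n) = (1 :: 'a)"
    by (simp add: mult.commute)
qed

text \<open>The coefficient rings in use have zero divisors, so cancellation rests on the explicit
  inverse supplied by \<open>rat_embed\<close>.\<close>

lemma of_nat_cancel:
  fixes a b :: "'a::rat_lambda_ring"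
  assumes "n \<noteq> 0" "of_nat n * a = of_nat n * b"
  shows "a = b"
proof -
  have "rat_embed (1 / of_nat n) * (of_nat n * a) = rat_embed (1 / of_nat n) * (of_nat n * b)"
    using assms(2) by simp
  then show ?thesis
    unfolding mult.assoc[symmetric] rat_embed_inverse_of_nat[OF assms(1)] by simp
qed

definition exp_partial :: "'a::rat_lambda_ring mps \<Rightarrow> nat \<Rightarrow> 'a mps" where
  "exp_partial F N = (\<Sum>k\<le>N. mps_const (rat_embed (1 / fact k)) * F ^ k)"

lemma exp_partial_stable:
  assumes "mcoeff F 0 = 0" "degree_of e \<le> N"
  shows "mcoeff (exp_partial F N) e = mcoeff (exp_partial F (degree_of e)) e"
  unfolding exp_partial_def mcoeff_sum
  by (rule sum.mono_neutral_right) (use assms in \<open>auto simp: mcoeff_power_eq_0\<close>)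

lemma mcoeff_mps_exp:
  assumes "mcoeff F 0 = 0" "degree_of e \<le> N"
  shows "mcoeff (mps_exp F) e = mcoeff (exp_partial F N) e"
proof -
  have "mps_limit (exp_partial F) (MPS (\<lambda>e. mcoeff (exp_partial F (degree_of e)) e))"
    unfolding mps_limit_def eventually_sequentially mcoeff_MPS
    using exp_partial_stable[OF assms(1)] by blast
  then have "mps_exp F = MPS (\<lambda>e. mcoeff (exp_partial F (degree_of e)) e)"
    unfolding mps_exp_def exp_partial_def[symmetric, abs_def] by (rule mps_lim_eq)
  then show ?thesis
    by (simp only: mcoeff_MPS exp_partial_stable[OF assms])
qed

lemma mcoeff_mps_exp_0: "mcoeff F 0 = 0 \<Longrightarrow> mcoeff (mps_exp F) 0 = 1"
  by (subst mcoeff_mps_exp[where N = 0])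
    (simp_all add: exp_partial_def rat_embed_1 mps_const_1 one_mps.rep_eq)

text \<open>The constant term is annihilated and \<open>(k+1) / (k+1)! = 1 / k!\<close>, so the
  derivative of one truncation is the derivative of \<open>F\<close> times the previous
  truncation.\<close>

lemma euler_exp_partial: "euler x (exp_partial F (Suc N)) = euler x F * exp_partial F N"
proof -
  have "mps_const (rat_embed (1 / fact (Suc k))) * of_nat (Suc k)
      = (mps_const (rat_embed (1 / fact k)) :: 'a mps)" for k
  proof -
    have "1 / fact (Suc k) * of_nat (Suc k) = (1 / fact k :: rat)"
      by (simp add: fact_Suc del: of_nat_Suc)
    then have "rat_embed (1 / fact (Suc k)) * of_nat (Suc k) = (rat_embed (1 / fact k) :: 'a)"
      by (metis rat_embed_mult rat_embed_of_nat)
    then show ?thesis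
      unfolding mps_const_of_nat[symmetric] mps_const_mult[symmetric] by simp
  qed
  then have step: "mps_const (rat_embed (1 / fact (Suc k))) * euler x (F ^ Suc k)
      = euler x F * (mps_const (rat_embed (1 / fact k)) * F ^ k)" for k
    unfolding euler_power mult.assoc[symmetric] by (simp only: ac_simps)
  have "euler x (exp_partial F (Suc N))
      = (\<Sum>k\<le>Suc N. mps_const (rat_embed (1 / fact k)) * euler x (F ^ k))"
    by (simp only: exp_partial_def euler_sum euler_const_times)
  also have "\<dots> = (\<Sum>k\<le>N. mps_const (rat_embed (1 / fact (Suc k))) * euler x (F ^ Suc k))"
    by (simp only: sum.atMost_Suc_shift power_0 euler_one mult_zero_right add_0)
  also have "\<dots> = euler x F * exp_partial F N"
    by (simp only: step exp_partial_def sum_distrib_left)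
  finally show ?thesis .
qed

lemma euler_mps_exp:
  assumes "mcoeff F 0 = 0"
  shows "euler x (mps_exp F) = euler x F * mps_exp F"
proof (rule mps_eqI)
  fix e
  \<comment> \<open>The truncation goes one step beyond the degree, since the Euler operator
    shortens it by one term.\<close>
  have "mcoeff (euler x (mps_exp F)) e = mcoeff (euler x (exp_partial F (Suc (degree_of e)))) e"
    by (simp add: mcoeff_euler mcoeff_mps_exp[OF assms, of e "Suc (degree_of e)"])
  also have "\<dots> = mcoeff (euler x F * mps_exp F) e"
    unfolding euler_exp_partial
    by (rule mcoeff_times_cong) (simp add: mcoeff_mps_exp[OF assms])
  finally show "mcoeff (euler x (mps_exp F)) e = mcoeff (euler x F * mps_exp F) e" .
qed

section \<open>Newton's identities and the plethystic exponential\<close>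

text \<open>
  \<open>newton P H\<close> relates the values \<open>P i\<close> of the power sums to the values \<open>H m\<close> of the complete
  symmetric functions; it determines \<open>H\<close> from \<open>P\<close> whenever positive integers can be cancelled.
\<close>

definition newton :: "(nat \<Rightarrow> 'a::comm_ring_1) \<Rightarrow> (nat \<Rightarrow> 'a) \<Rightarrow> bool" where
  "newton P H \<longleftrightarrow> H 0 = 1 \<and> (\<forall>m. of_nat m * H m = (\<Sum>i=1..m. P i * H (m - i)))"

lemma newton_0: "newton P H \<Longrightarrow> H 0 = 1"
  by (simp add: newton_def)

lemma newton_rec: "newton P H \<Longrightarrow> of_nat m * H m = (\<Sum>i=1..m. P i * H (m - i))"
  by (simp add: newton_def)

text \<open>For positive \<open>m\<close> the right-hand side involves only smaller indices of
  \<open>H\<close>, and the factor \<open>m\<close> on the left can be cancelled.\<close>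

lemma newton_unique:
  fixes P :: "nat \<Rightarrow> 'a::{comm_ring_1,ring_no_zero_divisors,semiring_char_0}"
  assumes "newton P H" "newton P' H'" "\<And>i. i \<ge> 1 \<Longrightarrow> P i = P' i"
  shows "H m = H' m"
proof (induction m rule: less_induct)
  case (less m)
  show ?case
  proof (cases "m = 0")
    case False
    have "of_nat m * H m = (\<Sum>i=1..m. P i * H (m - i))"
      by (rule newton_rec[OF assms(1)])
    also have "\<dots> = (\<Sum>i=1..m. P' i * H' (m - i))"
      by (rule sum.cong) (auto simp: assms(3) less.IH)
    also have "\<dots> = of_nat m * H' m"
      by (rule newton_rec[OF assms(2), symmetric])
    finally show ?thesis using False by simp
  qed (simp add: newton_0[OF assms(1)] newton_0[OF assms(2)])
qed

lemma of_nat_mult_rat_embed_div: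
  assumes "i \<noteq> 0"
  shows "of_nat (i * k) * rat_embed (1 / of_nat i) = (of_nat k :: 'a::rat_lambda_ring)"
  using rat_embed_inverse_of_nat(2)[OF assms, where 'a = 'a]
  by (metis (no_types, lifting) mult.assoc mult.commute mult.right_neutral of_nat_mult)

text \<open>Substituting i-th powers for the variables turns \<open>t_x^k\<close> into
  \<open>t_x^(i k)\<close>, while the scalar receives the Adams operation.\<close>

lemma power_sum_pleth_power_sum:
  assumes "i \<ge> 1"
  shows "power_sum_pleth i (mps_const c * power_sum k) = mps_const (adams i c) * power_sum (i * k)"
proof (rule mps_eqI)
  fix e
  show "mcoeff (power_sum_pleth i (mps_const c * power_sum k)) e
      = mcoeff (mps_const (adams i c) * power_sum (i * k)) e"
  proof (cases "\<forall>x. i dvd Poly_Mapping.lookup e x")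
    case True
    have "Poly_Mapping.map (\<lambda>k. k div i) e = Poly_Mapping.single x k
        \<longleftrightarrow> e = Poly_Mapping.single x (i * k)" for x
    proof -
      \<comment> \<open>\<open>Poly_Mapping.map\<close> acts only on nonzero entries, hence the
        guard; the two vectors are compared entry by entry.\<close>
      have "(Poly_Mapping.lookup e y div i when Poly_Mapping.lookup e y \<noteq> 0) = (k when x = y)
          \<longleftrightarrow> Poly_Mapping.lookup e y = (i * k when x = y)" for y
        using True[rule_format, of y] assms by (auto simp: when_def dvd_def)
      then show ?thesis
        by (simp add: poly_mapping_eq_iff fun_eq_iff map.rep_eq lookup_single)
    qed
    with True show ?thesis
      by (simp add: power_sum_pleth_def power_sum_def adams_zero)
  next
    case False
    then have "\<not> (\<exists>x. e = Poly_Mapping.single x (i * k))"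
      by (auto simp: lookup_single when_def split: if_splits)
    with False show ?thesis
      unfolding power_sum_pleth_def mcoeff_const_times power_sum_def mcoeff_MPS
      by (simp only: if_False mult_zero_right)
  qed
qed

lemma mcoeff_euler_power_sum:
  "mcoeff (euler x (mps_const c * power_sum m)) e
    = (if e = Poly_Mapping.single x m then of_nat m * c else 0)"
  by (auto simp: mcoeff_euler power_sum_def lookup_single when_def)

text \<open>The derivative of \<open>c p_m\<close> is the single monomial \<open>m c t_x^m\<close>,
  so multiplying by it is a shift of exponents. The case distinction is needed because subtraction
  of exponents truncates at zero.\<close>

lemma mcoeff_euler_power_sum_times:
  "mcoeff (euler x (mps_const c * power_sum m) * G) e
    = (if m \<le> Poly_Mapping.lookup e x then of_nat m * c * mcoeff G (e - Poly_Mapping.single x m) else 0)"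
proof -
  let ?s = "Poly_Mapping.single x m"
  have split: "(a, b) \<in> {(a, b). a + b = e} \<and> a = ?s
      \<longleftrightarrow> m \<le> Poly_Mapping.lookup e x \<and> (a, b) = (?s, e - ?s)" for a b
  proof -
    have "?s + (e - ?s) = e" if "m \<le> Poly_Mapping.lookup e x"
      using that by (auto intro!: poly_mapping_eqI simp: lookup_add lookup_minus lookup_single when_def)
    then show ?thesis
      by (auto simp: lookup_add)
  qed
  have "mcoeff (euler x (mps_const c * power_sum m) * G) e
      = (\<Sum>(a, b) | a + b = e \<and> a = ?s. of_nat m * c * mcoeff G b)"
    unfolding mcoeff_times mcoeff_euler_power_sum
    by (rule sum.mono_neutral_cong_right[OF finite_splittings]) (auto split: if_splits)
  also have "{(a, b). a + b = e \<and> a = ?s}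
      = (if m \<le> Poly_Mapping.lookup e x then {(?s, e - ?s)} else {})"
    using split by auto
  finally show ?thesis by simp
qed

text \<open>Logarithmic derivatives add up over a product; \<open>g i\<close> is the logarithmic
  derivative of \<open>f i\<close>.\<close>

lemma euler_prod:
  assumes "finite S" "\<And>i. i \<in> S \<Longrightarrow> euler x (f i) = g i * f i"
  shows "euler x (\<Prod>i\<in>S. f i) = (\<Sum>i\<in>S. g i) * (\<Prod>i\<in>S. f i)"
  using assms by (induction S rule: finite_induct) (simp_all add: euler_mult algebra_simps)

text \<open>
  The product of \<open>H\<close> over the exponents satisfies, in each variable, the recursion given by the
  logarithmic Euler derivative of the plethystic exponential.
\<close>

definition multiplicative_coeff :: "(nat \<Rightarrow> 'a::comm_ring_1) \<Rightarrow> (nat \<Rightarrow>\<^sub>0 nat) \<Rightarrow> 'a" where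
  "multiplicative_coeff H e = (\<Prod>y\<in>Poly_Mapping.keys e. H (Poly_Mapping.lookup e y))"

text \<open>Absent variables contribute \<open>H 0 = 1\<close>. This puts exponent vectors with
  different supports over one common index set.\<close>

lemma multiplicative_coeff_eq:
  assumes "H 0 = 1" "finite S" "Poly_Mapping.keys e \<subseteq> S"
  shows "multiplicative_coeff H e = (\<Prod>y\<in>S. H (Poly_Mapping.lookup e y))"
  unfolding multiplicative_coeff_def
  by (rule prod.mono_neutral_left) (use assms in \<open>auto simp: in_keys_iff\<close>)

text \<open>Lowering the exponent of \<open>x\<close> changes only the factor at \<open>x\<close>;
  the remaining product \<open>?R\<close> factors out of Newton's recursion for that one
  factor.\<close>

lemma multiplicative_coeff_rec:
  assumes "newton P H"
  shows "of_nat (Poly_Mapping.lookup e x) * multiplicative_coeff H e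
    = (\<Sum>j=1..Poly_Mapping.lookup e x. P j * multiplicative_coeff H (e - Poly_Mapping.single x j))"
proof -
  let ?S = "insert x (Poly_Mapping.keys e)"
  let ?R = "\<Prod>y\<in>?S - {x}. H (Poly_Mapping.lookup e y)"
  have *: "multiplicative_coeff H (e - Poly_Mapping.single x j) = H (Poly_Mapping.lookup e x - j) * ?R" for j
  proof -
    have "multiplicative_coeff H (e - Poly_Mapping.single x j)
        = (\<Prod>y\<in>?S. H (Poly_Mapping.lookup (e - Poly_Mapping.single x j) y))"
      by (rule multiplicative_coeff_eq[where H = H, OF newton_0[OF assms]])
        (auto simp: in_keys_iff lookup_minus)
    also have "\<dots> = H (Poly_Mapping.lookup e x - j)
        * (\<Prod>y\<in>?S - {x}. H (Poly_Mapping.lookup (e - Poly_Mapping.single x j) y))"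
      by (subst prod.remove[of ?S x]) (auto simp: lookup_minus)
    also have "(\<Prod>y\<in>?S - {x}. H (Poly_Mapping.lookup (e - Poly_Mapping.single x j) y)) = ?R"
      by (rule prod.cong) (auto simp: lookup_minus lookup_single)
    finally show ?thesis .
  qed
  show ?thesis
    \<comment> \<open>The instance \<open>j = 0\<close> gives the factorization of the coefficient
      at \<open>e\<close> itself.\<close>
    using *[of 0] newton_rec[OF assms, of "Poly_Mapping.lookup e x"]
    by (simp add: * sum_distrib_right flip: mult.assoc)
qed

definition Exp_partial :: "'a::rat_lambda_ring mps \<Rightarrow> nat \<Rightarrow> 'a mps" where
  "Exp_partial F N =
     (\<Prod>i=1..N. mps_exp (mps_const (rat_embed (1 / of_nat i)) * power_sum_pleth i F))"

text \<open>The i-th factor is the exponential of \<open>(1/i) (adams i c) p_(i k)\<close>.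
  Differentiation produces \<open>i k\<close>, which absorbs \<open>1/i\<close> and leaves
  \<open>k (adams i c) t_x^(i k)\<close> as its logarithmic derivative.\<close>

lemma mcoeff_Exp_partial_rec:
  fixes c :: "'a::rat_lambda_ring"
  assumes "k \<ge> 1"
  defines "F \<equiv> mps_const c * power_sum k"
  shows "of_nat (Poly_Mapping.lookup e x) * mcoeff (Exp_partial F N) e
    = (\<Sum>i\<in>{i\<in>{1..N}. i * k \<le> Poly_Mapping.lookup e x}.
         of_nat k * adams i c * mcoeff (Exp_partial F N) (e - Poly_Mapping.single x (i * k)))"
proof -
  define T where "T i = mps_const (rat_embed (1 / of_nat i)) * power_sum_pleth i F" for i
  have T: "T i = mps_const (rat_embed (1 / of_nat i) * adams i c) * power_sum (i * k)" if "i \<ge> 1" for i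
    unfolding T_def F_def power_sum_pleth_power_sum[OF that] by (simp only: mps_const_mult mult.assoc)
  have T0: "mcoeff (T i) 0 = 0" if "i \<ge> 1" for i
    using that assms(1) unfolding T[OF that] mcoeff_const_times
    by (auto simp: power_sum_def poly_mapping_eq_iff fun_eq_iff lookup_single when_def)
  have "euler x (Exp_partial F N) = (\<Sum>i=1..N. euler x (T i)) * Exp_partial F N"
    unfolding Exp_partial_def T_def[symmetric]
    by (rule euler_prod) (auto intro!: euler_mps_exp T0)
  then have "of_nat (Poly_Mapping.lookup e x) * mcoeff (Exp_partial F N) e
      = (\<Sum>i=1..N. mcoeff (euler x (T i) * Exp_partial F N) e)"
    by (simp add: mcoeff_euler[symmetric] sum_distrib_right mcoeff_sum)
  also have "\<dots> = (\<Sum>i=1..N. if i * k \<le> Poly_Mapping.lookup e x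
      then of_nat k * adams i c * mcoeff (Exp_partial F N) (e - Poly_Mapping.single x (i * k)) else 0)"
  proof (rule sum.cong[OF refl])
    fix i assume "i \<in> {1..N}"
    then have i: "i \<ge> 1" by simp
    then have "of_nat (i * k) * (rat_embed (1 / of_nat i) * adams i c) = of_nat k * adams i c"
      using of_nat_mult_rat_embed_div[of i k, where 'a = 'a] by (metis mult.assoc not_one_le_zero)
    then show "mcoeff (euler x (T i) * Exp_partial F N) e = (if i * k \<le> Poly_Mapping.lookup e x
      then of_nat k * adams i c * mcoeff (Exp_partial F N) (e - Poly_Mapping.single x (i * k)) else 0)"
      unfolding T[OF i] mcoeff_euler_power_sum_times by simp
  qed
  finally show ?thesis
    by (simp only: sum.inter_filter finite_atLeastAtMost)
qed

text \<open>Both sides obey the same recursion in any variable that occurs in \<open>e\<close>, and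
  that recursion lowers the total degree. Having \<open>N\<close> at least the degree ensures that
  no term is lost by stopping the product at \<open>N\<close>.\<close>

lemma mcoeff_Exp_partial:
  fixes c :: "'a::rat_lambda_ring"
  assumes k: "k \<ge> 1"
    and newton: "newton (\<lambda>i. if k dvd i then of_nat k * adams (i div k) c else 0) H"
    and "degree_of e \<le> N"
  defines "F \<equiv> mps_const c * power_sum k"
  shows "mcoeff (Exp_partial F N) e = multiplicative_coeff H e"
  using assms(3)
proof (induction "degree_of e" arbitrary: e rule: less_induct)
  case less
  show ?case
  proof (cases "e = 0")
    case True
    \<comment> \<open>In degree zero there is no variable to recurse on, so the constant term is
      computed directly: every factor has constant term 1.\<close>
    have "mcoeff (Exp_partial F M) 0 = 1" for M
    proof (induction M)
      case (Suc M)
      have "mcoeff (mps_const (rat_embed (1 / of_nat (Suc M))) * power_sum_pleth (Suc M) F) 0 = 0"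
        using k unfolding F_def
        by (subst power_sum_pleth_power_sum)
          (auto simp: power_sum_def poly_mapping_eq_iff fun_eq_iff lookup_single when_def)
      then have "mcoeff (mps_exp (mps_const (rat_embed (1 / of_nat (Suc M))) * power_sum_pleth (Suc M) F)) 0 = 1"
        by (rule mcoeff_mps_exp_0)
      moreover have "{(a, b). a + b = (0 :: nat \<Rightarrow>\<^sub>0 nat)} = {(0, 0)}"
        by (auto simp: poly_mapping_eq_iff fun_eq_iff lookup_add)
      ultimately show ?case using Suc by (simp add: Exp_partial_def mcoeff_times)
    qed (simp add: Exp_partial_def one_mps.rep_eq)
    then show ?thesis by (simp add: True multiplicative_coeff_def)
  next
    case False
    then obtain x where x: "Poly_Mapping.lookup e x \<noteq> 0"
      by (auto simp: poly_mapping_eq_iff fun_eq_iff)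
    let ?m = "Poly_Mapping.lookup e x"
    have IH: "mcoeff (Exp_partial F N) (e - Poly_Mapping.single x j)
        = multiplicative_coeff H (e - Poly_Mapping.single x j)" if "1 \<le> j" "j \<le> ?m" for j
    proof (rule less.hyps)
      have "(e - Poly_Mapping.single x j) + Poly_Mapping.single x j = e"
        using that by (auto intro!: poly_mapping_eqI simp: lookup_add lookup_minus lookup_single when_def)
      from arg_cong[OF this, of degree_of]
      have "degree_of (e - Poly_Mapping.single x j) + j = degree_of e"
        by (simp add: degree_of_add)
      then show "degree_of (e - Poly_Mapping.single x j) < degree_of e"
        "degree_of (e - Poly_Mapping.single x j) \<le> N"
        using that less.prems by auto
    qed
    have "of_nat ?m * mcoeff (Exp_partial F N) e = (\<Sum>i\<in>{i\<in>{1..N}. i * k \<le> ?m}.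
         of_nat k * adams i c * mcoeff (Exp_partial F N) (e - Poly_Mapping.single x (i * k)))"
      unfolding F_def by (rule mcoeff_Exp_partial_rec[OF k])
    also have "\<dots> = (\<Sum>j\<in>{j\<in>{1..?m}. k dvd j}. of_nat k * adams (j div k) c
        * multiplicative_coeff H (e - Poly_Mapping.single x j))"
    proof (rule sum.reindex_bij_witness[where i = "\<lambda>j. j div k" and j = "\<lambda>i. i * k"])
      fix j assume j: "j \<in> {j\<in>{1..?m}. k dvd j}"
      \<comment> \<open>The cut-off at \<open>N\<close> is invisible: \<open>j\<close> is at most
        one exponent of \<open>e\<close>, hence at most its degree.\<close>
      then have "j \<le> N"
        using lookup_le_degree_of[of e x] less.prems by simp
      then have "j div k \<le> N"
        by (rule order_trans[OF div_le_dividend])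
      then show "j div k \<in> {i \<in> {1..N}. i * k \<le> ?m}"
        using j k by (auto simp: dvd_def)
    qed (use k in \<open>auto simp: IH\<close>)
    also have "\<dots> = (\<Sum>j=1..?m. (if k dvd j then of_nat k * adams (j div k) c else 0)
        * multiplicative_coeff H (e - Poly_Mapping.single x j))"
      by (simp only: sum.inter_filter finite_atLeastAtMost) (rule sum.cong, auto)
    also have "\<dots> = of_nat ?m * multiplicative_coeff H e"
      by (rule multiplicative_coeff_rec[OF newton, symmetric])
    finally show ?thesis by (rule of_nat_cancel[OF x])
  qed
qed

text \<open>The coefficient at \<open>e\<close> is constant from \<open>N = degree_of e\<close> on,
  so the partial products converge coefficientwise.\<close>

lemma mcoeff_Exp_sigma_power_sum:
  assumes "k \<ge> 1" "newton (\<lambda>i. if k dvd i then of_nat k * adams (i div k) c else 0) H"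
  shows "mcoeff (Exp_sigma (mps_const c * power_sum k)) e = multiplicative_coeff H e"
proof -
  have "mps_limit (Exp_partial (mps_const c * power_sum k)) (MPS (multiplicative_coeff H))"
    unfolding mps_limit_def eventually_sequentially
    using mcoeff_Exp_partial[OF assms] by auto
  then have "Exp_sigma (mps_const c * power_sum k) = MPS (multiplicative_coeff H)"
    unfolding Exp_sigma_def Exp_partial_def[symmetric, abs_def] by (rule mps_lim_eq)
  then show ?thesis by simp
qed

text \<open>This is \<open>h_m\<close> applied to \<open>c\<close> in the lambda-ring: Newton's
  recursion solved for its top term, dividing by the index.\<close>

fun complete_of :: "'a::rat_lambda_ring \<Rightarrow> nat \<Rightarrow> 'a" where
  "complete_of c 0 = 1"
| "complete_of c (Suc m) =
     rat_embed (1 / of_nat (Suc m)) * (\<Sum>i\<le>m. adams (Suc i) c * complete_of c (m - i))"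

lemma newton_complete_of: "newton (\<lambda>i. adams i c) (complete_of c)"
proof -
  have "of_nat m * complete_of c m = (\<Sum>i=1..m. adams i c * complete_of c (m - i))" for m
  proof (cases m)
    case (Suc n)
    have "of_nat (Suc n) * complete_of c (Suc n) = (\<Sum>i\<le>n. adams (Suc i) c * complete_of c (n - i))"
      unfolding complete_of.simps mult.assoc[symmetric]
      by (subst rat_embed_inverse_of_nat(2)) simp_all
    also have "\<dots> = (\<Sum>i=1..Suc n. adams i c * complete_of c (Suc n - i))"
      by (rule sum.reindex_bij_witness[where i = "\<lambda>i. i - 1" and j = Suc]) auto
    finally show ?thesis by (simp only: Suc)
  qed simp
  then show ?thesis by (simp add: newton_def)
qed

text \<open>Newton's recursion uses ring operations only, so ring homomorphisms preserve it. It is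
  applied to evaluation at a matrix followed by \<open>sum_value\<close>.\<close>

lemma newton_hom:
  assumes "newton P H"
    and one: "\<phi> 1 = 1" and add: "\<And>x y. \<phi> (x + y) = \<phi> x + \<phi> y" and mult: "\<And>x y. \<phi> (x * y) = \<phi> x * \<phi> y"
  shows "newton (\<lambda>i. \<phi> (P i)) (\<lambda>m. \<phi> (H m))"
    "multiplicative_coeff (\<lambda>m. \<phi> (H m)) e = \<phi> (multiplicative_coeff H e)"
proof -
  have zero: "\<phi> 0 = 0" using add[of 0 0] by simp
  have sum: "\<phi> (sum f A) = (\<Sum>x\<in>A. \<phi> (f x))" for f and A :: "nat set"
    by (induction A rule: infinite_finite_induct) (simp_all add: zero add)
  have of_nat: "\<phi> (of_nat m) = of_nat m" for m
    by (induction m) (simp_all add: zero add one)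
  have "\<phi> (of_nat m * H m) = \<phi> (\<Sum>i=1..m. P i * H (m - i))" for m
    using newton_rec[OF assms(1)] by simp
  then show "newton (\<lambda>i. \<phi> (P i)) (\<lambda>m. \<phi> (H m))"
    using newton_0[OF assms(1)] by (simp add: newton_def sum mult of_nat one)
  have prod: "\<phi> (prod f A) = (\<Prod>x\<in>A. \<phi> (f x))" for f and A :: "nat set"
    by (induction A rule: infinite_finite_induct) (simp_all add: one mult)
  show "multiplicative_coeff (\<lambda>m. \<phi> (H m)) e = \<phi> (multiplicative_coeff H e)"
    by (simp add: multiplicative_coeff_def prod)
qed

section \<open>Moment generating functions in terms of traces\<close>

lemma sum_value_superset:
  assumes "finite S" "Poly_Mapping.keys f \<subseteq> S"
  shows "sum_value f = (\<Sum>k\<in>S. of_rat (Poly_Mapping.lookup f k) * complex_val k)"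
  unfolding sum_value_def by (rule sum.mono_neutral_left) (use assms in \<open>auto simp: in_keys_iff\<close>)

lemma sum_value_0 [simp]: "sum_value 0 = 0"
  by (simp add: sum_value_def)

lemma sum_value_add: "sum_value (f + g) = sum_value f + sum_value g"
proof -
  let ?S = "Poly_Mapping.keys f \<union> Poly_Mapping.keys g"
  have "sum_value (f + g) = (\<Sum>k\<in>?S. of_rat (Poly_Mapping.lookup (f + g) k) * complex_val k)"
    by (rule sum_value_superset) (simp_all add: Poly_Mapping.keys_add)
  then show ?thesis
    by (simp add: sum_value_superset[of ?S f] sum_value_superset[of ?S g] lookup_add of_rat_add
        distrib_right sum.distrib)
qed

lemma sum_value_sum: "sum_value (sum f A) = (\<Sum>x\<in>A. sum_value (f x))"
  by (induction A rule: infinite_finite_induct) (simp_all add: sum_value_add)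

lemma sum_value_single [simp]: "sum_value (Poly_Mapping.single k a) = of_rat a * complex_val k"
  by (cases "a = 0") (simp_all add: sum_value_def)

lemma sum_value_one [simp]: "sum_value 1 = 1"
  by (simp flip: single_one add: zero_mult_complex_def)

text \<open>Since \<open>[z][w] = [zw]\<close>, evaluating formal sums is a ring homomorphism to the
  complex numbers.\<close>

lemma sum_value_mult: "sum_value (f * g) = sum_value f * sum_value g"
proof -
  have expand: "h = (\<Sum>k\<in>Poly_Mapping.keys h. Poly_Mapping.single k (Poly_Mapping.lookup h k))" for h :: formal_sum
    by (rule poly_mapping_eqI) (simp add: lookup_sum lookup_single when_def in_keys_iff)
  have "f * g = (\<Sum>k\<in>Poly_Mapping.keys f. \<Sum>l\<in>Poly_Mapping.keys g.
      Poly_Mapping.single (k + l) (Poly_Mapping.lookup f k * Poly_Mapping.lookup g l))"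
    by (subst expand[of f], subst expand[of g]) (simp only: sum_product mult_single)
  also have "sum_value \<dots> = sum_value f * sum_value g"
    by (simp add: sum_value_sum plus_mult_complex_def of_rat_mult sum_value_def[of f]
        sum_value_def[of g] sum_product ac_simps)
  finally show ?thesis .
qed

lemma adams_single:
  "adams i (Poly_Mapping.single k a) = Poly_Mapping.single (nat_multiple i k) (adams i a)"
  by (cases "a = 0") (simp_all add: adams_poly_mapping_def adams_zero)

lemma sum_value_adams_eigenvalue_sum:
  "sum_value (adams i (eigenvalue_sum A)) = (\<Sum>z\<in>#proots (char_poly A). z ^ i)"
proof -
  \<comment> \<open>Repeated addition in \<open>mult_complex\<close> is repeated multiplication of
    complex numbers.\<close>
  have val: "complex_val (nat_multiple i (Mult_Complex z)) = z ^ i" for z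
    by (induction i) (simp_all add: zero_mult_complex_def plus_mult_complex_def)
  have "sum_value (adams i (\<Sum>z\<in>#M. Poly_Mapping.single (Mult_Complex z) 1)) = (\<Sum>z\<in>#M. z ^ i)" for M
    by (induction M)
      (simp_all add: adams_zero adams_add sum_value_add adams_single adams_one val)
  then show ?thesis by (simp add: eigenvalue_sum_def)
qed

lemma complete_sym_1: "complete_sym 1 = power_sum 1"
proof -
  have "degree_of e = 1 \<longleftrightarrow> (\<exists>i. e = Poly_Mapping.single i 1)" for e
  proof
    assume deg: "degree_of e = 1"
    then obtain x where x: "Poly_Mapping.lookup e x \<noteq> 0"
      by (metis degree_of_eq_0_iff lookup_zero poly_mapping_eqI zero_neq_one)
    then have "(e - Poly_Mapping.single x 1) + Poly_Mapping.single x 1 = e"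
      by (auto intro!: poly_mapping_eqI simp: lookup_add lookup_minus lookup_single when_def)
    moreover from arg_cong[OF this, of degree_of] have "degree_of (e - Poly_Mapping.single x 1) = 0"
      by (simp add: degree_of_add deg)
    ultimately show "\<exists>i. e = Poly_Mapping.single i 1"
      by (metis add_0 degree_of_eq_0_iff)
  qed auto
  then show ?thesis by (simp add: complete_sym_def power_sum_def)
qed

lemma newton_cong:
  assumes "newton P H" "\<And>i. i \<ge> 1 \<Longrightarrow> P i = P' i"
  shows "newton P' H"
proof -
  have "(\<Sum>i=1..m. P i * H (m - i)) = (\<Sum>i=1..m. P' i * H (m - i))" for m
    by (rule sum.cong) (use assms(2) in auto)
  then show ?thesis using assms(1) by (simp add: newton_def)
qed

definition complete_at_eigenvalues :: "complex mat \<Rightarrow> nat \<Rightarrow> complex" where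
  "complete_at_eigenvalues g m = sum_value (complete_of eigenvalue_sum m g)"

lemma newton_complete_at_eigenvalues:
  "newton (\<lambda>i. \<Sum>z\<in>#proots (char_poly g). z ^ i) (complete_at_eigenvalues g)"
proof -
  have "newton (\<lambda>i. sum_value (adams i eigenvalue_sum g)) (complete_at_eigenvalues g)"
    unfolding complete_at_eigenvalues_def[abs_def]
    by (rule newton_hom(1)[OF newton_complete_of, where \<phi> = "\<lambda>f. sum_value (f g)"]) (simp_all add: sum_value_add sum_value_mult)
  then show ?thesis by (simp add: adams_fun_def sum_value_adams_eigenvalue_sum)
qed

text \<open>Evaluation at each \<open>g\<close> commutes with forming the product over the
  exponents; the average is taken afterwards.\<close>

lemma mcoeff_sigma_mgf:
  "mcoeff (sigma_mgf G) e
    = (\<Sum>g\<in>G. multiplicative_coeff (complete_at_eigenvalues g) e) / of_nat (card G)"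
proof -
  let ?H = "complete_of eigenvalue_sum"
  \<comment> \<open>The case \<open>k = 1\<close> of the general formula, where the divisibility
    condition always holds.\<close>
  have "newton (\<lambda>i. if 1 dvd i then of_nat 1 * adams (i div 1) eigenvalue_sum else 0) ?H"
    by (rule newton_cong[OF newton_complete_of]) simp
  then have "mcoeff (Exp_sigma (mps_const eigenvalue_sum * complete_sym 1)) e = multiplicative_coeff ?H e"
    unfolding complete_sym_1 by (rule mcoeff_Exp_sigma_power_sum[OF order.refl])
  moreover have "sum_value (multiplicative_coeff ?H e g) = multiplicative_coeff (complete_at_eigenvalues g) e" for g
    unfolding complete_at_eigenvalues_def[abs_def]
    by (rule newton_hom(2)[OF newton_complete_of, where \<phi> = "\<lambda>f. sum_value (f g)", symmetric])
      (simp_all add: sum_value_add sum_value_mult)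
  ultimately show ?thesis
    by (simp add: sigma_mgf_def map_mps_def expectation_def)
qed

section \<open>Traces of powers and power sums of eigenvalues\<close>

definition mat_trace :: "'a::comm_monoid_add mat \<Rightarrow> 'a" where
  "mat_trace A = (\<Sum>i<dim_row A. A $$ (i, i))"

lemma mat_trace_smult:
  fixes A :: "'a::semiring_0 mat"
  assumes "A \<in> carrier_mat n n"
  shows "mat_trace (c \<cdot>\<^sub>m A) = c * mat_trace A"
  using assms by (auto simp: mat_trace_def sum_distrib_left intro!: sum.cong)

lemma mat_trace_mult:
  assumes "A \<in> carrier_mat n m" "B \<in> carrier_mat m n"
  shows "mat_trace (A * B) = (\<Sum>i<n. \<Sum>j<m. A $$ (i, j) * B $$ (j, i))"
  using assms by (auto simp: mat_trace_def scalar_prod_def atLeast0LessThan intro!: sum.cong)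

lemma mat_trace_mult_commute:
  fixes A :: "'a::comm_semiring_0 mat"
  assumes "A \<in> carrier_mat n m" "B \<in> carrier_mat m n"
  shows "mat_trace (A * B) = mat_trace (B * A)"
  by (subst mat_trace_mult[OF assms], subst mat_trace_mult[OF assms(2,1)], subst sum.swap)
    (simp add: mult.commute)

lemma mat_trace_similar:
  fixes A :: "'a::comm_ring_1 mat"
  assumes "similar_mat_wit A B P Q"
  shows "mat_trace A = mat_trace B"
proof -
  define n where "n = dim_row A"
  note d = similar_mat_witD[OF n_def assms]
  have "mat_trace A = mat_trace (P * (B * Q))"
    using d by (simp add: assoc_mult_mat[of P n n B n Q n])
  also have "\<dots> = mat_trace ((B * Q) * P)"
    using d by (intro mat_trace_mult_commute[of _ n n]) auto
  also have "(B * Q) * P = B"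
    using d by (simp add: assoc_mult_mat[of B n n Q n P n])
  finally show ?thesis .
qed

lemma upper_triangular_mult:
  fixes A :: "'a::comm_ring_1 mat"
  assumes "A \<in> carrier_mat n n" "B \<in> carrier_mat n n" "upper_triangular A" "upper_triangular B"
  shows "upper_triangular (A * B)"
    and "i < n \<Longrightarrow> (A * B) $$ (i, i) = A $$ (i, i) * B $$ (i, i)"
proof -
  have entry: "(A * B) $$ (i, j) = (\<Sum>k<n. A $$ (i, k) * B $$ (k, j))" if "i < n" "j < n" for i j
    using that assms by (simp add: scalar_prod_def atLeast0LessThan)
  show "upper_triangular (A * B)"
  proof (rule upper_triangularI)
    fix i j assume ij: "j < i" "i < dim_row (A * B)"
    \<comment> \<open>If \<open>k < i\<close> the first factor lies below the diagonal; otherwise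
      \<open>j < i \<le> k\<close> and the second one does.\<close>
    have "A $$ (i, k) * B $$ (k, j) = 0" if "k < n" for k
      using assms ij that unfolding upper_triangular_def by (cases "k < i") auto
    then show "(A * B) $$ (i, j) = 0"
      using ij assms(1) by (subst entry) auto
  qed
  assume i: "i < n"
  have "A $$ (i, k) * B $$ (k, i) = 0" if "k < n" "k \<noteq> i" for k
    using assms i that unfolding upper_triangular_def by (cases "k < i") auto
  then have "(\<Sum>k<n. A $$ (i, k) * B $$ (k, i)) = (\<Sum>k\<in>{i}. A $$ (i, k) * B $$ (k, i))"
    using i by (intro sum.mono_neutral_right) auto
  then show "(A * B) $$ (i, i) = A $$ (i, i) * B $$ (i, i)"
    using entry[OF i i] by simp
qed

lemma upper_triangular_pow:
  fixes A :: "'a::comm_ring_1 mat"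
  assumes "A \<in> carrier_mat n n" "upper_triangular A"
  shows "upper_triangular (A ^\<^sub>m k) \<and> (\<forall>i<n. (A ^\<^sub>m k) $$ (i, i) = (A $$ (i, i)) ^ k)"
proof (induction k)
  case 0
  show ?case using assms by auto
next
  case (Suc k)
  have "A ^\<^sub>m k \<in> carrier_mat n n" using assms by simp
  with Suc upper_triangular_mult[OF this assms(1) _ assms(2)] show ?case
    by (simp add: mult.commute)
qed

text \<open>By Schur decomposition \<open>A\<close> is similar to a triangular matrix with the
  eigenvalues on its diagonal. Powers of it carry the powers of the eigenvalues there, and the trace
  is invariant under similarity.\<close>

lemma sum_proots_char_poly_power:
  fixes A :: "complex mat"
  assumes A: "A \<in> carrier_mat n n"
  shows "(\<Sum>z\<in>#proots (char_poly A). z ^ i) = mat_trace (A ^\<^sub>m i)"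
proof -
  obtain es where es: "char_poly A = (\<Prod>e\<leftarrow>es. [:- e, 1:])"
    using char_poly_factorized[OF A] by auto
  obtain B P Q where "schur_decomposition A es = (B, P, Q)"
    by (cases "schur_decomposition A es") auto
  then have sim: "similar_mat_wit A B P Q" and tri: "upper_triangular B" and diag: "diag_mat B = es"
    using schur_decomposition[OF A es] by auto
  have B: "B \<in> carrier_mat n n"
    using similar_mat_witD2[OF A sim] by auto
  \<comment> \<open>Matches the list of diagonal entries with the multiset of roots, multiplicities
    included.\<close>
  have "proots (\<Prod>e\<leftarrow>xs. [:- e, 1:]) = mset xs" for xs :: "complex list"
  proof (induction xs)
    case (Cons x xs)
    have "(\<Prod>e\<leftarrow>xs. [:- e, 1:]) \<noteq> 0"
      by (simp add: prod_list_zero_iff image_iff)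
    then show ?case
      by (simp only: list.map prod_list.Cons proots_mult pCons_eq_0_iff one_neq_zero simp_thms
          proots_linear_factor Cons.IH) simp
  qed simp
  then have "(\<Sum>z\<in>#proots (char_poly A). z ^ i) = (\<Sum>z\<leftarrow>es. z ^ i)"
    unfolding es by (simp flip: mset_map add: sum_mset_sum_list)
  also have "\<dots> = (\<Sum>j<n. (B $$ (j, j)) ^ i)"
    using B by (simp flip: diag add: diag_mat_def interv_sum_list_conv_sum_set_nat atLeast0LessThan o_def)
  also have "\<dots> = mat_trace (B ^\<^sub>m i)"
    using upper_triangular_pow[OF B tri, of i] B by (simp add: mat_trace_def)
  also have "\<dots> = mat_trace (A ^\<^sub>m i)"
    by (rule mat_trace_similar[OF similar_mat_wit_pow[OF sim], symmetric])
  finally show ?thesis .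
qed

text \<open>The way every group element is treated below: a sequence that solves Newton's recursion
  for the traces of powers must be the sequence of complete symmetric functions of the
  eigenvalues.\<close>

lemma complete_at_eigenvalues_eqI:
  assumes "A \<in> carrier_mat n n" "newton (\<lambda>i. mat_trace (A ^\<^sub>m i)) H"
  shows "complete_at_eigenvalues A = H"
  by (rule ext, rule newton_unique[OF newton_complete_at_eigenvalues assms(2)])
    (simp add: sum_proots_char_poly_power[OF assms(1)])

section \<open>Symmetric power series\<close>

text \<open>Beyond some \<open>N\<close> all exponents vanish, so it suffices to sort the first
  \<open>N\<close> positions and fix the others.\<close>

lemma partition_rearrangement:
  fixes e :: "nat \<Rightarrow>\<^sub>0 nat"
  obtains \<tau> \<pi> where "is_partition \<tau>" "bij \<pi>" "Poly_Mapping.lookup e = Poly_Mapping.lookup \<tau> \<circ> \<pi>"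
proof -
  define f where "f = Poly_Mapping.lookup e"
  obtain N where N: "Poly_Mapping.keys e \<subseteq> {..<N}"
    using finite_nat_iff_bounded[of "Poly_Mapping.keys e"] by auto
  then have f0: "f i = 0" if "i \<ge> N" for i
    using that by (auto simp: f_def in_keys_iff subset_iff)
  \<comment> \<open>The negated key makes the order decreasing; it is taken in the integers, where
    negation is faithful.\<close>
  define xs where "xs = sort_key (\<lambda>i. - int (f i)) [0..<N]"
  have len: "length xs = N" and dist: "distinct xs" and set: "set xs = {..<N}"
    by (auto simp: xs_def)
  define \<sigma> where "\<sigma> i = (if i < N then xs ! i else i)" for i
  have bij_N: "bij_betw \<sigma> {..<N} {..<N}"
  proof (subst bij_betw_cong)
    show "bij_betw ((!) xs) {..<N} {..<N}"
      by (rule bij_betw_nth[OF dist]) (simp_all add: len set)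
  qed (simp add: \<sigma>_def)
  have "bij_betw \<sigma> {N..} {N..}"
  proof (subst bij_betw_cong)
    show "bij_betw id {N..} {N..}" by simp
  qed (simp add: \<sigma>_def)
  moreover have "{..<N} \<inter> {N..} = {}" "{..<N} \<union> {N..} = UNIV" by auto
  ultimately have "bij \<sigma>"
    using bij_betw_combine[OF bij_N] by metis
  have "finite {i. f (\<sigma> i) \<noteq> 0}"
    by (rule finite_subset[of _ "{..<N}"]) (auto simp: \<sigma>_def f0 split: if_splits)
  then have lookup: "Poly_Mapping.lookup (Abs_poly_mapping (f \<circ> \<sigma>)) = f \<circ> \<sigma>"
    by (simp add: Abs_poly_mapping_inverse)
  have anti: "f (\<sigma> j) \<le> f (\<sigma> i)" if "i \<le> j" for i j
  proof (cases "j < N")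
    case True
    have "sorted (map (\<lambda>i. - int (f i)) xs)"
      by (simp add: xs_def)
    from sorted_nth_mono[OF this \<open>i \<le> j\<close>] True that len show ?thesis
      by (simp add: \<sigma>_def)
  next
    case False
    then have "f (\<sigma> j) = 0" by (simp add: \<sigma>_def f0)
    then show ?thesis by simp
  qed
  show ?thesis
  proof (rule that)
    show "is_partition (Abs_poly_mapping (f \<circ> \<sigma>))"
      unfolding is_partition_def lookup by (rule antimonoI) (simp add: anti)
    show "bij (inv_into UNIV \<sigma>)" using \<open>bij \<sigma>\<close> by (rule bij_imp_bij_inv)
    show "Poly_Mapping.lookup e = Poly_Mapping.lookup (Abs_poly_mapping (f \<circ> \<sigma>)) \<circ> inv_into UNIV \<sigma>"
      unfolding lookup using \<open>bij \<sigma>\<close> by (simp add: fun_eq_iff f_def surj_f_inv_f bij_is_surj)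
  qed
qed

text \<open>Exactly one partition is a rearrangement of \<open>e\<close>, so a single summand
  survives. This covers exponent vectors that are not sorted.\<close>

lemma mcoeff_monomial_sum_perm:
  assumes "is_partition \<tau>" "bij \<pi>" "Poly_Mapping.lookup e = Poly_Mapping.lookup \<tau> \<circ> \<pi>"
  shows "mcoeff (monomial_sum a) e = a \<tau>"
proof -
  have one: "mcoeff (monomial_sym \<tau> :: 'a mps) e = 1"
    using assms by (auto simp: monomial_sym_def)
  have "mcoeff (monomial_sym \<rho> :: 'a mps) e \<noteq> 0 \<longleftrightarrow> \<rho> = \<tau>" if \<rho>: "is_partition \<rho>" for \<rho>
  proof
    assume "mcoeff (monomial_sym \<rho> :: 'a mps) e \<noteq> 0"
    then obtain \<rho>' where \<rho>': "bij \<rho>'" "Poly_Mapping.lookup e = Poly_Mapping.lookup \<rho> \<circ> \<rho>'"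
      by (auto simp: monomial_sym_def split: if_splits)
    have "Poly_Mapping.lookup \<tau> = Poly_Mapping.lookup e \<circ> inv_into UNIV \<pi>"
      using assms(2,3) by (simp add: fun_eq_iff surj_f_inv_f bij_is_surj)
    then have "Poly_Mapping.lookup \<tau> = Poly_Mapping.lookup \<rho> \<circ> (\<rho>' \<circ> inv_into UNIV \<pi>)"
      by (simp add: \<rho>'(2) o_assoc)
    then show "\<rho> = \<tau>"
      using partition_perm_unique[OF \<rho> assms(1)] bij_comp[OF bij_imp_bij_inv[OF assms(2)] \<rho>'(1)] by auto
  qed (simp add: one)
  then have "{\<rho>. is_partition \<rho> \<and> mcoeff (monomial_sym \<rho> :: 'a mps) e \<noteq> 0} = {\<tau>}"
    using assms(1) by auto
  then show ?thesis by (simp add: monomial_sum_def one)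
qed

lemma multiplicative_coeff_perm:
  assumes "bij \<pi>" "Poly_Mapping.lookup e = Poly_Mapping.lookup \<tau> \<circ> \<pi>"
  shows "multiplicative_coeff H e = multiplicative_coeff H \<tau>"
  unfolding multiplicative_coeff_def
proof (rule prod.reindex_bij_witness[where j = \<pi> and i = "inv_into UNIV \<pi>"])
qed (use assms in \<open>auto simp: in_keys_iff bij_is_inj bij_is_surj surj_f_inv_f\<close>)

text \<open>The support of a non-increasing sequence is closed downwards and finite, hence an
  initial segment.\<close>

lemma keys_partition:
  assumes "is_partition \<tau>"
  shows "Poly_Mapping.keys \<tau> = {..<num_parts \<tau>}"
proof -
  have down: "i \<in> Poly_Mapping.keys \<tau>" if "j \<in> Poly_Mapping.keys \<tau>" "i \<le> j" for i j
    using antimonoD[OF assms[unfolded is_partition_def] that(2)] that(1) by (simp add: in_keys_iff)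
  define m where "m = (LEAST i. i \<notin> Poly_Mapping.keys \<tau>)"
  have "m \<notin> Poly_Mapping.keys \<tau>"
    unfolding m_def by (rule LeastI_ex) (metis ex_new_if_finite finite_keys infinite_UNIV_nat)
  then have "Poly_Mapping.keys \<tau> = {..<m}"
    using down not_less_Least[of _ "\<lambda>i. i \<notin> Poly_Mapping.keys \<tau>", folded m_def]
    by (auto simp: not_le[symmetric])
  then show ?thesis by (simp add: num_parts_def)
qed

lemma multiplicative_coeff_partition:
  "is_partition \<tau> \<Longrightarrow> multiplicative_coeff H \<tau> = (\<Prod>r<num_parts \<tau>. H (Poly_Mapping.lookup \<tau> r))"
  by (simp add: multiplicative_coeff_def keys_partition)

text \<open>A symmetric power series is determined by its coefficients at partitions, since every
  exponent vector can be sorted.\<close>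

lemma mps_eq_partitionI:
  assumes "\<And>e \<tau> \<pi>. bij \<pi> \<Longrightarrow> Poly_Mapping.lookup e = Poly_Mapping.lookup \<tau> \<circ> \<pi> \<Longrightarrow> mcoeff F e = mcoeff F \<tau>"
    and "\<And>\<tau>. is_partition \<tau> \<Longrightarrow> mcoeff F \<tau> = a \<tau>"
  shows "F = monomial_sum a"
proof (rule mps_eqI)
  fix e :: "nat \<Rightarrow>\<^sub>0 nat"
  obtain \<tau> \<pi> where "is_partition \<tau>" "bij \<pi>" "Poly_Mapping.lookup e = Poly_Mapping.lookup \<tau> \<circ> \<pi>"
    by (rule partition_rearrangement[of e])
  then show "mcoeff F e = mcoeff (monomial_sum a) e"
    by (metis assms mcoeff_monomial_sum_perm)
qed

lemma sigma_mgf_eqI: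
  assumes "\<And>\<tau>. is_partition \<tau> \<Longrightarrow> mcoeff (sigma_mgf G) \<tau> = a \<tau>"
  shows "sigma_mgf G = monomial_sum a"
  by (rule mps_eq_partitionI[OF _ assms]) (simp_all add: mcoeff_sigma_mgf multiplicative_coeff_perm)

section \<open>Solutions of Newton's identities\<close>

text \<open>The case of a single eigenvalue \<open>z\<close>.\<close>

lemma newton_power: "newton (\<lambda>i. z ^ i) (\<lambda>m. z ^ m)"
proof -
  have "(\<Sum>i=1..m. z ^ i * z ^ (m - i)) = of_nat m * z ^ m" for m
  proof -
    have "(\<Sum>i=1..m. z ^ i * z ^ (m - i)) = (\<Sum>i=1..m. z ^ m)"
      by (rule sum.cong) (auto simp flip: power_add)
    then show ?thesis by simp
  qed
  then show ?thesis by (simp add: newton_def)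
qed

text \<open>In generating functions the recursion reads \<open>t h' = p h\<close>. The recursion
  sums from \<open>i = 1\<close>, hence the constant term of \<open>p\<close> is subtracted.\<close>

lemma newton_iff_fps:
  "newton P H \<longleftrightarrow> H 0 = 1 \<and>
     fps_X * fps_deriv (Abs_fps H) = (Abs_fps P - fps_const (P 0)) * Abs_fps H"
proof -
  have "fps_nth (fps_X * fps_deriv (Abs_fps H)) m = of_nat m * H m" for m
    by (cases m) simp_all
  moreover have "fps_nth ((Abs_fps P - fps_const (P 0)) * Abs_fps H) m = (\<Sum>i=1..m. P i * H (m - i))" for m
    unfolding fps_mult_nth by (rule sum.mono_neutral_cong_right) auto
  ultimately show ?thesis by (simp add: newton_def fps_eq_iff)
qed

text \<open>Joining two families of eigenvalues adds power sums and multiplies the generating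
  functions of the complete symmetric functions; this is the product rule for
  \<open>t h' = p h\<close>.\<close>

lemma newton_add:
  assumes "newton P H" "newton P' H'"
  shows "newton (\<lambda>i. P i + P' i) (\<lambda>m. \<Sum>i\<le>m. H i * H' (m - i))"
proof -
  let ?h = "Abs_fps H" and ?h' = "Abs_fps H'"
  have conv: "Abs_fps (\<lambda>m. \<Sum>i\<le>m. H i * H' (m - i)) = ?h * ?h'"
    by (simp add: fps_eq_iff fps_mult_nth atLeast0AtMost)
  have p: "Abs_fps (\<lambda>i. P i + P' i) = Abs_fps P + Abs_fps P'"
    by (simp add: fps_eq_iff)
  have "fps_X * fps_deriv (?h * ?h') = (fps_X * fps_deriv ?h) * ?h' + ?h * (fps_X * fps_deriv ?h')"
    by (simp add: algebra_simps)
  also have "\<dots> = ((Abs_fps P - fps_const (P 0)) * ?h) * ?h' + ?h * ((Abs_fps P' - fps_const (P' 0)) * ?h')"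
    using assms by (simp only: newton_iff_fps)
  also have "\<dots> = (Abs_fps P + Abs_fps P' - fps_const (P 0 + P' 0)) * (?h * ?h')"
    by (simp add: algebra_simps flip: fps_const_add)
  finally show ?thesis
    unfolding newton_iff_fps conv p using assms by (simp add: newton_0)
qed

text \<open>The case of one eigenvalue \<open>u\<close> of multiplicity \<open>N\<close>: the
  right-hand sequence consists of the coefficients of \<open>(1 - u t)^(-N)\<close>.\<close>

lemma newton_binomial:
  assumes "N \<ge> 1"
  shows "newton (\<lambda>i. of_nat N * u ^ i) (\<lambda>m. of_nat ((N + m - 1) choose m) * u ^ m)"
proof -
  have "of_nat m * (of_nat ((N + m - 1) choose m) * u ^ m)
      = (\<Sum>i=1..m. of_nat N * u ^ i * (of_nat ((N + (m - i) - 1) choose (m - i)) * u ^ (m - i)))" for m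
  proof (cases m)
    case (Suc n)
    have u: "u ^ i * (c * u ^ (m - i)) = c * u ^ m" if "i \<le> m" for i c
      using that by (simp add: mult.left_commute flip: power_add)
    have "(\<Sum>i=1..m. of_nat N * u ^ i * (of_nat ((N + (m - i) - 1) choose (m - i)) * u ^ (m - i)))
        = (\<Sum>j\<le>n. of_nat N * of_nat ((N + j - 1) choose j) * u ^ m)"
      by (rule sum.reindex_bij_witness[where i = "\<lambda>j. m - j" and j = "\<lambda>i. m - i"])
        (auto simp: Suc mult.assoc u[unfolded Suc, simplified])
    also have "\<dots> = of_nat (N * (\<Sum>j\<le>n. (N - 1 + j) choose j)) * u ^ m"
      using assms by (simp add: sum_distrib_left sum_distrib_right)
    \<comment> \<open>The hockey-stick identity; the next equation is the absorption identity for
      binomial coefficients.\<close>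
    also have "(\<Sum>j\<le>n. (N - 1 + j) choose j) = (N + n) choose n"
      unfolding sum_choose_lower using assms by simp
    also have "N * ((N + n) choose n) = m * ((N + m - 1) choose m)"
    proof -
      have "Suc n * ((N + n) choose Suc n) = N * ((N + n) choose n)"
        using Suc_times_binomial_add[of n "N - 1"] assms by (simp add: add.commute)
      then show ?thesis using assms by (simp add: Suc)
    qed
    finally show ?thesis by simp
  qed simp
  then show ?thesis by (simp add: newton_def)
qed

text \<open>Passing from \<open>t\<close> to \<open>t\<^sup>k\<close> in the generating function.\<close>

lemma newton_dilate:
  assumes "newton P H" "k \<ge> 1"
  shows "newton (\<lambda>i. if k dvd i then of_nat k * P (i div k) else 0)
    (\<lambda>m. if k dvd m then H (m div k) else 0)" (is "newton ?P ?H")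
proof -
  have "of_nat m * ?H m = (\<Sum>i=1..m. ?P i * ?H (m - i))" for m
  proof (cases "k dvd m")
    case True
    then obtain l where l: "m = k * l" by auto
    have "(\<Sum>i=1..m. ?P i * ?H (m - i)) = (\<Sum>i\<in>{i\<in>{1..m}. k dvd i}. ?P i * ?H (m - i))"
      by (rule sum.mono_neutral_right) auto
    also have "\<dots> = (\<Sum>j=1..l. of_nat k * (P j * H (l - j)))"
      by (rule sum.reindex_bij_witness[where i = "\<lambda>j. k * j" and j = "\<lambda>i. i div k"])
        (use assms(2) in \<open>auto simp: l dvd_def simp flip: right_diff_distrib'\<close>)
    also have "\<dots> = of_nat k * (of_nat l * H l)"
      by (simp add: newton_rec[OF assms(1)] sum_distrib_left)
    finally show ?thesis using assms(2) by (simp add: l)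
  next
    case False
    have "?P i * ?H (m - i) = 0" if "i \<in> {1..m}" for i
    proof -
      have "\<not> (k dvd i \<and> k dvd (m - i))"
        using False that by (metis atLeastAtMost_iff dvd_add le_add_diff_inverse)
      then show ?thesis by auto
    qed
    then have "(\<Sum>i=1..m. ?P i * ?H (m - i)) = 0" by (rule sum.neutral[OF ballI])
    with False show ?thesis by simp
  qed
  then show ?thesis by (simp add: newton_def newton_0[OF assms(1)])
qed

section \<open>Cyclic and dihedral groups\<close>

lemma multiplicative_coeff_power:
  "multiplicative_coeff (\<lambda>m. z ^ m) e = z ^ degree_of e"
  by (simp add: multiplicative_coeff_def degree_of_def power_sum)

lemma multiplicative_coeff_mult:
  "multiplicative_coeff (\<lambda>m. H m * H' m) e = multiplicative_coeff H e * multiplicative_coeff H' e"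
  by (simp add: multiplicative_coeff_def prod.distrib)

text \<open>One odd exponent makes its factor, and so the product, vanish. The parity distinction in
  the Pauli coefficients comes from here.\<close>

lemma multiplicative_coeff_even:
  assumes "H 0 = 1"
  shows "multiplicative_coeff (\<lambda>m. if even m then H m else 0) e
    = (if \<forall>r. even (Poly_Mapping.lookup e r) then multiplicative_coeff H e else (0 :: 'a::{comm_ring_1,semidom}))"
proof (cases "\<forall>r. even (Poly_Mapping.lookup e r)")
  case False
  then obtain r where r: "odd (Poly_Mapping.lookup e r)" by auto
  then have "r \<in> Poly_Mapping.keys e" by (auto simp: in_keys_iff intro: ccontr)
  then have "(\<Prod>y\<in>Poly_Mapping.keys e. if even (Poly_Mapping.lookup e y) then H (Poly_Mapping.lookup e y) else 0) = 0"
    using r by (intro prod_zero) auto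
  with False show ?thesis by (simp add: multiplicative_coeff_def)
qed (simp add: multiplicative_coeff_def)

lemma cis_root: "cis (2 * pi * real j / real n) = cis (2 * pi / real n) ^ j"
  by (simp add: DeMoivre algebra_simps)

text \<open>Integer exponents are used because the dihedral exponents
  \<open>|\<tau>| - 2 \<Sum> r_i\<close> can be negative.\<close>

lemma cis_eq_1_iff_dvd:
  assumes "n \<ge> 1"
  shows "cis (2 * pi / real n) powi k = 1 \<longleftrightarrow> int n dvd k"
proof -
  have "cis (2 * pi / real n) powi k = cis (of_int k * (2 * pi / real n))"
    by (simp add: cis_power_int)
  also have "\<dots> = 1 \<longleftrightarrow> cos (of_int k * (2 * pi / real n)) = 1"
    using cos_one_sin_zero by (auto simp: complex_eq_iff)
  also have "\<dots> \<longleftrightarrow> (\<exists>l::int. of_int k * (2 * pi / real n) = of_int l * (2 * pi))"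
    by (simp add: cos_one_2pi_int mult.assoc)
  also have "\<dots> \<longleftrightarrow> (\<exists>l::int. k = int n * l)"
  proof -
    have "of_int k * (2 * pi / real n) = of_int l * (2 * pi) \<longleftrightarrow> k = int n * l" for l :: int
    proof -
      have "of_int k * (2 * pi / real n) = of_int l * (2 * pi) \<longleftrightarrow> real_of_int k = real n * real_of_int l"
        using assms by (simp add: field_simps)
      also have "real n * real_of_int l = real_of_int (int n * l)" by simp
      finally show ?thesis by (simp only: of_int_eq_iff)
    qed
    then show ?thesis by simp
  qed
  finally show ?thesis by (simp add: dvd_def)
qed

text \<open>A geometric sum with ratio \<open>?w\<close>, where \<open>?w ^ n = 1\<close>; it
  vanishes unless the ratio itself is 1.\<close>

lemma sum_roots_of_unity_powers:
  assumes "n \<ge> 1"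
  shows "(\<Sum>j<n. (cis (2 * pi * real j / real n)) powi k) = (if int n dvd k then of_nat n else 0)"
proof -
  let ?w = "cis (2 * pi / real n) powi k"
  have eq: "cis (2 * pi * real j / real n) powi k = ?w ^ j" for j
    unfolding cis_root power_int_of_nat[symmetric] power_int_mult[symmetric] by (simp only: mult.commute)
  show ?thesis
  proof (cases "int n dvd k")
    case True
    then have "?w = 1" using cis_eq_1_iff_dvd[OF assms] by simp
    with True show ?thesis unfolding eq by simp
  next
    case False
    then have "?w \<noteq> 1" using cis_eq_1_iff_dvd[OF assms] by simp
    moreover have "?w ^ n = 1"
    proof -
      have "?w ^ n = cis (2 * pi / real n) powi (k * int n)"
        by (simp add: power_int_mult)
      also have "\<dots> = 1" using cis_eq_1_iff_dvd[OF assms] by simp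
      finally show ?thesis .
    qed
    ultimately have "(\<Sum>j<n. ?w ^ j) = 0" by (simp add: sum_gp_strict)
    with False show ?thesis unfolding eq by simp
  qed
qed

lemma inj_on_cis_roots:
  assumes "n \<ge> 1"
  shows "inj_on (\<lambda>j. cis (2 * pi * real j / real n)) {..<n}"
proof (rule inj_onI)
  fix i j assume ij: "i \<in> {..<n}" "j \<in> {..<n}"
    and eq: "cis (2 * pi * real i / real n) = cis (2 * pi * real j / real n)"
  have "cis (2 * pi / real n) powi (int i - int j) = 1"
    using eq unfolding cis_root by (simp add: power_int_diff)
  then have "int n dvd int i - int j" using cis_eq_1_iff_dvd[OF assms] by simp
  then show "i = j" using ij zdvd_imp_le[of "int n" "int i - int j"] zdvd_imp_le[of "int n" "int j - int i"]
    by (cases i j rule: linorder_cases) (auto simp: dvd_diff_commute)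
qed

section \<open>The cyclic group\<close>

lemma cyclic_matrices_eq:
  "cyclic_matrices n = (\<lambda>j. mat 1 1 (\<lambda>_. cis (2 * pi * real j / real n))) ` {..<n}"
proof -
  have "mat_of_rows_list 1 [[exp (2 * of_real pi * \<i> * of_nat j / of_nat n)]]
      = mat 1 1 (\<lambda>_. cis (2 * pi * real j / real n))" for j
    by (rule eq_matI) (auto simp: mat_of_rows_list_def cis_conv_exp mult_ac)
  then show ?thesis by (simp add: cyclic_matrices_def)
qed

lemma mat_1_power: "mat 1 1 (\<lambda>_. z :: complex) ^\<^sub>m i = mat 1 1 (\<lambda>_. z ^ i)"
proof (induction i)
  case (Suc i)
  show ?case
    unfolding pow_mat.simps Suc
    by (rule eq_matI) (auto simp: scalar_prod_def mult.commute)
qed (rule eq_matI, auto)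

lemma sigma_mgf_cyclic:
  assumes "n \<ge> 1"
  shows "sigma_mgf (cyclic_matrices n) = monomial_sum (\<lambda>\<tau>. if n dvd degree_of \<tau> then 1 else 0)"
proof -
  let ?M = "\<lambda>j. mat 1 1 (\<lambda>_. cis (2 * pi * real j / real n))"
  \<comment> \<open>The group is a set of matrices; injectivity turns the average over it into an
    average over \<open>j\<close>.\<close>
  have "inj_on ?M {..<n}"
  proof (rule inj_onI)
    fix i j assume ij: "i \<in> {..<n}" "j \<in> {..<n}" and eq: "?M i = ?M j"
    have "?M i $$ (0, 0) = ?M j $$ (0, 0)" by (simp only: eq)
    then have "cis (2 * pi * real i / real n) = cis (2 * pi * real j / real n)" by simp
    then show "i = j" using inj_on_cis_roots[OF assms] ij by (auto dest: inj_onD)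
  qed
  then have card: "card (cyclic_matrices n) = n"
    and sum: "(\<Sum>g\<in>cyclic_matrices n. f g) = (\<Sum>j<n. f (?M j))" for f :: "complex mat \<Rightarrow> complex"
    by (simp_all add: cyclic_matrices_eq card_image sum.reindex)
  have vals: "complete_at_eigenvalues (mat 1 1 (\<lambda>_. z)) = (\<lambda>m. z ^ m)" for z
  proof (rule complete_at_eigenvalues_eqI[of _ 1])
    show "newton (\<lambda>i. mat_trace (mat 1 1 (\<lambda>_. z) ^\<^sub>m i)) (\<lambda>m. z ^ m)"
      using newton_power[of z] unfolding mat_1_power by (simp add: mat_trace_def)
  qed simp
  show ?thesis
  proof (rule sigma_mgf_eqI)
    fix \<tau>
    have "mcoeff (sigma_mgf (cyclic_matrices n)) \<tau>
        = (\<Sum>j<n. cis (2 * pi * real j / real n) powi int (degree_of \<tau>)) / of_nat n"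
      by (simp add: mcoeff_sigma_mgf sum card vals multiplicative_coeff_power del: One_nat_def)
    also have "\<dots> = (if n dvd degree_of \<tau> then 1 else 0)"
      using assms by (subst sum_roots_of_unity_powers) auto
    finally show "mcoeff (sigma_mgf (cyclic_matrices n)) \<tau> = (if n dvd degree_of \<tau> then 1 else 0)" .
  qed
qed

section \<open>Rotations and reflections of the plane\<close>

lemma rotation_eq:
  "rotation \<theta> = mat 2 2 (\<lambda>(i, j). complex_of_real
    (if i = j then cos \<theta> else if i = 0 then - sin \<theta> else sin \<theta>))"
  by (rule eq_matI) (auto simp: rotation_def mat_of_rows_list_def less_2_cases_iff)

lemma reflection_eq:
  "reflection \<theta> = mat 2 2 (\<lambda>(i, j). complex_of_real
    (if i = j then (if i = 0 then cos \<theta> else - cos \<theta>) else sin \<theta>))"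
  by (rule eq_matI) (auto simp: reflection_def mat_of_rows_list_def less_2_cases_iff)

lemma sum_lessThan_2: "(\<Sum>i<2. f i) = f 0 + f (1 :: nat)"
  by (simp add: numeral_2_eq_2)

lemma rotation_mult: "rotation \<alpha> * rotation \<beta> = rotation (\<alpha> + \<beta>)"
  by (rule eq_matI)
    (auto simp: rotation_eq scalar_prod_def atLeast0LessThan sum_lessThan_2 less_2_cases_iff
      cos_add sin_add algebra_simps)

lemma rotation_power: "rotation \<theta> ^\<^sub>m i = rotation (real i * \<theta>)"
proof (induction i)
  case 0
  show ?case by (rule eq_matI) (auto simp: rotation_eq less_2_cases_iff)
next
  case (Suc i)
  then show ?case by (simp add: rotation_mult algebra_simps)
qed

text \<open>The eigenvalues are \<open>cis (- \<theta>)\<close> and \<open>cis \<theta>\<close>. The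
  index \<open>r\<close> counts how often the first is chosen and becomes an entry
  \<open>r_i\<close> of the tuples in the dihedral formula.\<close>

lemma complete_at_eigenvalues_rotation:
  "complete_at_eigenvalues (rotation \<theta>) = (\<lambda>m. \<Sum>r\<le>m. cis \<theta> powi (int m - 2 * int r))"
proof -
  have trace: "mat_trace (rotation \<theta> ^\<^sub>m i) = cis (- \<theta>) ^ i + cis \<theta> ^ i" for i
    unfolding rotation_power by (simp add: mat_trace_def rotation_eq sum_lessThan_2 DeMoivre complex_eq_iff)
  have "cis (- \<theta>) ^ r * cis \<theta> ^ (m - r) = cis \<theta> powi (int m - 2 * int r)" if "r \<le> m" for r m
  proof -
    have "cis \<theta> powi (int m - 2 * int r) = cis \<theta> powi (- int r + int (m - r))"
      using that by (simp add: of_nat_diff)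
    also have "\<dots> = cis \<theta> powi (- int r) * cis \<theta> powi int (m - r)"
      by (rule power_int_add) simp
    finally show ?thesis
      by (simp add: power_int_minus power_inverse flip: cis_inverse)
  qed
  then have conv: "(\<Sum>r\<le>m. cis (- \<theta>) ^ r * cis \<theta> ^ (m - r)) = (\<Sum>r\<le>m. cis \<theta> powi (int m - 2 * int r))" for m
    by simp
  show ?thesis
  proof (rule complete_at_eigenvalues_eqI)
    show "rotation \<theta> \<in> carrier_mat 2 2" by (simp add: rotation_eq)
    show "newton (\<lambda>i. mat_trace (rotation \<theta> ^\<^sub>m i)) (\<lambda>m. \<Sum>r\<le>m. cis \<theta> powi (int m - 2 * int r))"
      using newton_add[OF newton_power newton_power, of "cis (- \<theta>)" "cis \<theta>"]
      unfolding trace conv .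
  qed
qed

text \<open>Even powers of \<open>A\<close> are scalar and odd powers are multiples of
  \<open>A\<close>, hence of trace 0. The traces are those of eigenvalues \<open>u\<close> and
  \<open>-u\<close>, each of multiplicity \<open>N\<close>, with generating function
  \<open>(1 - u^2 t^2)^(-N)\<close>: the binomial series for \<open>u^2\<close> dilated by
  2.\<close>

lemma complete_at_eigenvalues_square_scalar:
  assumes A: "A \<in> carrier_mat (2 * N) (2 * N)" and "N \<ge> 1"
    and square: "A * A = u ^ 2 \<cdot>\<^sub>m 1\<^sub>m (2 * N)" and trace: "mat_trace A = 0"
  shows "complete_at_eigenvalues A
    = (\<lambda>m. if even m then of_nat ((N + m div 2 - 1) choose (m div 2)) * u ^ m else 0)"
proof (rule complete_at_eigenvalues_eqI[OF A])
  have even_power: "A ^\<^sub>m (2 * j) = u ^ (2 * j) \<cdot>\<^sub>m 1\<^sub>m (2 * N)" for j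
  proof (induction j)
    case (Suc j)
    have "A ^\<^sub>m (2 * Suc j) = A ^\<^sub>m (2 * j) * (A * A)"
      using A by (simp add: assoc_mult_mat[of _ "2 * N" "2 * N" _ "2 * N" _ "2 * N"])
    also have "\<dots> = u ^ (2 * Suc j) \<cdot>\<^sub>m 1\<^sub>m (2 * N)"
      unfolding Suc square by (rule eq_matI) (auto simp: power2_eq_square ac_simps)
    finally show ?case .
  qed (use A in auto)
  have "mat_trace (A ^\<^sub>m i) = (if 2 dvd i then of_nat 2 * (of_nat N * (u ^ 2) ^ (i div 2)) else 0)" for i
  proof (cases "even i")
    case True
    then obtain j where "i = 2 * j" by auto
    then show ?thesis by (simp only: even_power) (simp add: mat_trace_def power_mult)
  next
    case False
    then obtain j where i: "i = Suc (2 * j)" by (auto elim: oddE)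
    have "A ^\<^sub>m i = u ^ (2 * j) \<cdot>\<^sub>m A"
      using A unfolding i pow_mat.simps even_power by (simp add: mult_smult_assoc_mat[of _ "2 * N" "2 * N" _ "2 * N"])
    then have "mat_trace (A ^\<^sub>m i) = u ^ (2 * j) * mat_trace A"
      by (simp add: mat_trace_smult[OF A])
    with False trace show ?thesis by simp
  qed
  moreover have "(if 2 dvd m then of_nat ((N + m div 2 - 1) choose (m div 2)) * (u ^ 2) ^ (m div 2) else 0)
      = (if even m then of_nat ((N + m div 2 - 1) choose (m div 2)) * u ^ m else 0)" for m
    by (auto simp flip: power_mult)
  ultimately show "newton (\<lambda>i. mat_trace (A ^\<^sub>m i))
      (\<lambda>m. if even m then of_nat ((N + m div 2 - 1) choose (m div 2)) * u ^ m else 0)"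
    using newton_dilate[OF newton_binomial[OF \<open>N \<ge> 1\<close>, of "u ^ 2"], of 2] by simp
qed

lemma complete_at_eigenvalues_reflection:
  "complete_at_eigenvalues (reflection \<theta>) = (\<lambda>m. if even m then 1 else 0)"
proof -
  have "reflection \<theta> * reflection \<theta> = 1 ^ 2 \<cdot>\<^sub>m 1\<^sub>m (2 * 1)"
    by (rule eq_matI)
      (auto simp: reflection_eq scalar_prod_def atLeast0LessThan sum_lessThan_2 less_2_cases_iff
        simp flip: of_real_mult of_real_add power2_eq_square)
  moreover have "reflection \<theta> \<in> carrier_mat (2 * 1) (2 * 1)"
    by (simp add: reflection_eq)
  moreover have "mat_trace (reflection \<theta>) = 0"
    by (simp add: mat_trace_def reflection_eq sum_lessThan_2)
  ultimately show ?thesis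
    \<comment> \<open>For \<open>N = 1\<close> and \<open>u = 1\<close> the binomial coefficients
      are all 1.\<close>
    by (subst complete_at_eigenvalues_square_scalar[of _ 1 1]) (auto simp: fun_eq_iff)
qed

text \<open>Adams operations fix rational numbers, so the data are those of the eigenvalue 1 with
  multiplicity \<open>N\<close>, dilated by \<open>k\<close>. In each variable the series is
  \<open>(1 - t^k)^(-N)\<close>.\<close>

lemma mcoeff_Exp_sigma_of_nat_power_sum:
  assumes "N \<ge> 1" "k \<ge> 1"
  shows "mcoeff (map_mps of_rat (Exp_sigma (of_nat N * power_sum k))) e
    = (multiplicative_coeff (\<lambda>m. if k dvd m then of_nat ((N + m div k - 1) choose (m div k)) else 0) e
       :: 'a::field_char_0)"
proof -
  have "newton (\<lambda>i. if k dvd i then of_nat k * adams (i div k) (of_nat N :: rat) else 0)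
      (\<lambda>m. if k dvd m then of_nat ((N + m div k - 1) choose (m div k)) else 0)"
    using newton_dilate[OF newton_binomial[OF assms(1), of 1] assms(2)]
    by (simp add: adams_rat_def cong: if_cong)
  from mcoeff_Exp_sigma_power_sum[OF assms(2) this] show ?thesis
    by (simp add: mps_const_of_nat map_mps_def multiplicative_coeff_def of_rat_prod if_distrib cong: if_cong)
qed

lemma mcoeff_Exp_sigma_power_sum_2:
  "mcoeff (map_mps of_rat (Exp_sigma (power_sum 2))) e
    = (multiplicative_coeff (\<lambda>m. if even m then 1 else 0) e :: 'a::field_char_0)"
  using mcoeff_Exp_sigma_of_nat_power_sum[of 1 2 e, where 'a = 'a] by (simp cong: if_cong)

section \<open>Counting tuples and averaging over the dihedral group\<close>

text \<open>Integer lists are traded for functions in \<open>PiE\<close>, the form in which a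
  product of sums expands.\<close>

lemma card_dihedral_tuples:
  assumes "is_partition \<tau>"
  defines "S \<equiv> {..<num_parts \<tau>}"
  shows "card (dihedral_tuples n \<tau>) = card {f \<in> PiE S (\<lambda>i. {..Poly_Mapping.lookup \<tau> i}).
    int n dvd (\<Sum>i\<in>S. int (Poly_Mapping.lookup \<tau> i) - 2 * int (f i))}" (is "_ = card ?F")
proof -
  let ?s = "num_parts \<tau>"
  have deg: "int (degree_of \<tau>) - 2 * (\<Sum>i<?s. g i) = (\<Sum>i\<in>S. int (Poly_Mapping.lookup \<tau> i) - 2 * g i)" for g
    using degree_of_eq_sum[of S \<tau>] keys_partition[OF assms(1)]
    by (simp add: S_def sum_subtractf sum_distrib_left)
  have sum_list: "sum_list rs = (\<Sum>i<?s. rs ! i)" if "length rs = ?s" for rs :: "int list"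
    using that by (simp add: sum_list_sum_nth atLeast0LessThan)
  have "bij_betw (\<lambda>f. map (\<lambda>i. int (f i)) [0..<?s]) ?F (dihedral_tuples n \<tau>)"
  proof (rule bij_betw_byWitness[where f' = "\<lambda>rs. restrict (\<lambda>i. nat (rs ! i)) S"])
    show "\<forall>f\<in>?F. restrict (\<lambda>i. nat (map (\<lambda>i. int (f i)) [0..<?s] ! i)) S = f"
      by (auto simp: S_def PiE_iff extensional_def fun_eq_iff)
    show "\<forall>rs\<in>dihedral_tuples n \<tau>. map (\<lambda>i. int (restrict (\<lambda>i. nat (rs ! i)) S i)) [0..<?s] = rs"
      by (auto simp: dihedral_tuples_def S_def intro!: nth_equalityI)
    show "(\<lambda>f. map (\<lambda>i. int (f i)) [0..<?s]) ` ?F \<subseteq> dihedral_tuples n \<tau>"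
      by (auto simp: dihedral_tuples_def PiE_iff S_def sum_list deg[unfolded S_def])
    show "(\<lambda>rs. restrict (\<lambda>i. nat (rs ! i)) S) ` dihedral_tuples n \<tau> \<subseteq> ?F"
      by (auto simp: dihedral_tuples_def S_def sum_list deg[unfolded S_def] nat_le_iff split: if_splits)
  qed
  then show ?thesis by (rule bij_betw_same_card[symmetric])
qed

text \<open>Expanding the product over the parts gives one power of \<open>cis \<theta>\<close> for
  each choice function. After exchanging the sums, each choice contributes \<open>n\<close> or
  0.\<close>

lemma sum_rotations:
  assumes "is_partition \<tau>" "n \<ge> 1"
  shows "(\<Sum>j<n. multiplicative_coeff (complete_at_eigenvalues (rotation (2 * pi * real j / real n))) \<tau>)
    = of_nat n * of_nat (card (dihedral_tuples n \<tau>))"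
proof -
  define S where "S = {..<num_parts \<tau>}"
  let ?P = "PiE S (\<lambda>i. {..Poly_Mapping.lookup \<tau> i})"
  let ?d = "\<lambda>f. \<Sum>i\<in>S. int (Poly_Mapping.lookup \<tau> i) - 2 * int (f i)"
  have fin: "finite ?P" by (auto simp: S_def intro: finite_PiE)
  have "multiplicative_coeff (complete_at_eigenvalues (rotation \<theta>)) \<tau> = (\<Sum>f\<in>?P. cis \<theta> powi ?d f)" for \<theta>
  proof -
    have powi_sum: "(\<Prod>i\<in>T. cis \<theta> powi h i) = cis \<theta> powi (\<Sum>i\<in>T. h i)" if "finite T" for T :: "nat set" and h
      using that by (induction T rule: finite_induct) (simp_all add: power_int_add)
    have "multiplicative_coeff (complete_at_eigenvalues (rotation \<theta>)) \<tau>
        = (\<Prod>i\<in>S. \<Sum>r\<le>Poly_Mapping.lookup \<tau> i. cis \<theta> powi (int (Poly_Mapping.lookup \<tau> i) - 2 * int r))"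
      by (simp add: complete_at_eigenvalues_rotation multiplicative_coeff_partition[OF assms(1)] S_def)
    also have "\<dots> = (\<Sum>f\<in>?P. \<Prod>i\<in>S. cis \<theta> powi (int (Poly_Mapping.lookup \<tau> i) - 2 * int (f i)))"
      by (rule prod_sum_PiE) (simp_all add: S_def)
    finally show ?thesis by (simp add: powi_sum S_def)
  qed
  then have "(\<Sum>j<n. multiplicative_coeff (complete_at_eigenvalues (rotation (2 * pi * real j / real n))) \<tau>)
      = (\<Sum>f\<in>?P. \<Sum>j<n. cis (2 * pi * real j / real n) powi ?d f)"
    by (simp only:) (rule sum.swap)
  also have "\<dots> = (\<Sum>f\<in>?P. if int n dvd ?d f then of_nat n else 0)"
    by (simp only: sum_roots_of_unity_powers[OF assms(2)])
  also have "\<dots> = of_nat n * of_nat (card {f\<in>?P. int n dvd ?d f})"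
    using fin by (simp flip: sum.inter_filter)
  finally show ?thesis
    by (simp add: card_dihedral_tuples[OF assms(1)] S_def)
qed

lemma sigma_mgf_dihedral:
  assumes "n \<ge> 1"
  shows "sigma_mgf (dihedral_matrices n)
    = mps_const (1 / 2) * monomial_sum (\<lambda>\<tau>. of_nat (card (dihedral_tuples n \<tau>)))
      + mps_const (1 / 2) * map_mps of_rat (Exp_sigma (power_sum 2))"
proof (rule mps_eqI)
  fix e :: "nat \<Rightarrow>\<^sub>0 nat"
  let ?a = "\<lambda>j. 2 * pi * real j / real n"
  \<comment> \<open>The first column of either kind of matrix is the cosine and sine of its angle,
    which determines \<open>j\<close>.\<close>
  have cis_eq: "i = j" if "cos (?a i) = cos (?a j)" "sin (?a i) = sin (?a j)" "i < n" "j < n" for i j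
    using inj_on_cis_roots[OF assms] that by (auto simp: inj_on_def complex_eq_iff)
  have inj1: "inj_on (\<lambda>j. rotation (?a j)) {..<n}"
  proof (rule inj_onI)
    fix i j assume ij: "i \<in> {..<n}" "j \<in> {..<n}" and eq: "rotation (?a i) = rotation (?a j)"
    have "rotation (?a i) $$ (0, 0) = rotation (?a j) $$ (0, 0)" "rotation (?a i) $$ (1, 0) = rotation (?a j) $$ (1, 0)"
      by (simp_all only: eq)
    then show "i = j" using ij by (intro cis_eq) (simp_all add: rotation_eq)
  qed
  have inj2: "inj_on (\<lambda>j. reflection (?a j)) {..<n}"
  proof (rule inj_onI)
    fix i j assume ij: "i \<in> {..<n}" "j \<in> {..<n}" and eq: "reflection (?a i) = reflection (?a j)"
    have "reflection (?a i) $$ (0, 0) = reflection (?a j) $$ (0, 0)" "reflection (?a i) $$ (1, 0) = reflection (?a j) $$ (1, 0)"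
      by (simp_all only: eq)
    then show "i = j" using ij by (intro cis_eq) (simp_all add: reflection_eq)
  qed
  \<comment> \<open>Diagonal entries agree in a rotation and are opposite in a reflection, and
    conversely off the diagonal; equality would make cosine and sine both 0. So the order is
    \<open>2 * n\<close> for small \<open>n\<close> as well.\<close>
  have ne: "rotation \<alpha> \<noteq> reflection \<beta>" for \<alpha> \<beta>
  proof
    assume eq: "rotation \<alpha> = reflection \<beta>"
    have "rotation \<alpha> $$ p = reflection \<beta> $$ p" for p by (simp only: eq)
    from this[of "(0, 0)"] this[of "(0, 1)"] this[of "(1, 0)"] this[of "(1, 1)"]
    have "cos \<alpha> = 0" "sin \<alpha> = 0"
      by (simp_all add: rotation_eq reflection_eq del: of_real_minus flip: of_real_minus)
    then show False using sin_cos_squared_add[of \<alpha>] by simp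
  qed
  have disj: "(\<lambda>j. rotation (?a j)) ` {..<n} \<inter> (\<lambda>j. reflection (?a j)) ` {..<n} = {}"
    using ne by auto
  have card: "card (dihedral_matrices n) = 2 * n"
    unfolding dihedral_matrices_def using inj1 inj2 disj by (simp add: card_Un_disjoint card_image)
  have sum: "(\<Sum>g\<in>dihedral_matrices n. f g) = (\<Sum>j<n. f (rotation (?a j))) + (\<Sum>j<n. f (reflection (?a j)))"
    for f :: "complex mat \<Rightarrow> complex"
    unfolding dihedral_matrices_def using inj1 inj2 disj by (simp add: sum.union_disjoint sum.reindex)
  obtain \<tau> \<pi> where \<tau>: "is_partition \<tau>" and \<pi>: "bij \<pi>" "Poly_Mapping.lookup e = Poly_Mapping.lookup \<tau> \<circ> \<pi>"
    by (rule partition_rearrangement[of e])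
  have "mcoeff (sigma_mgf (dihedral_matrices n)) e
      = (\<Sum>g\<in>dihedral_matrices n. multiplicative_coeff (complete_at_eigenvalues g) \<tau>) / (2 * of_nat n)"
    by (simp add: mcoeff_sigma_mgf card multiplicative_coeff_perm[OF \<pi>])
  also have "\<dots> = 1 / 2 * of_nat (card (dihedral_tuples n \<tau>))
      + 1 / 2 * multiplicative_coeff (\<lambda>m. if even m then 1 else 0) \<tau>"
    unfolding sum sum_rotations[OF \<tau> assms] complete_at_eigenvalues_reflection
    using assms by (simp add: field_simps)
  also have "\<dots> = mcoeff (mps_const (1 / 2) * monomial_sum (\<lambda>\<tau>. of_nat (card (dihedral_tuples n \<tau>)))
      + mps_const (1 / 2) * map_mps of_rat (Exp_sigma (power_sum 2))) e"
    by (simp add: plus_mps.rep_eq mcoeff_monomial_sum_perm[OF \<tau> \<pi>] mcoeff_Exp_sigma_power_sum_2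
        multiplicative_coeff_perm[OF \<pi>])
  finally show "mcoeff (sigma_mgf (dihedral_matrices n)) e
    = mcoeff (mps_const (1 / 2) * monomial_sum (\<lambda>\<tau>. of_nat (card (dihedral_tuples n \<tau>)))
      + mps_const (1 / 2) * map_mps of_rat (Exp_sigma (power_sum 2))) e" .
qed

section \<open>Tensor products of matrices\<close>

lemma kronecker_carrier:
  "A \<in> carrier_mat a a' \<Longrightarrow> B \<in> carrier_mat b b' \<Longrightarrow> kronecker A B \<in> carrier_mat (a * b) (a' * b')"
  by (rule carrier_matI) (simp_all add: kronecker_def)

text \<open>Row-major flattening \<open>k = p * b + q\<close> of a pair of indices, as used by
  \<open>kronecker\<close>.\<close>

lemma sum_div_mod:
  "(\<Sum>k<a * b. f (k div b) (k mod b)) = (\<Sum>p<a. \<Sum>q<(b::nat). f p q)"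
proof -
  have "(\<Sum>p<a. \<Sum>q<b. f p q) = (\<Sum>(p, q)\<in>{..<a} \<times> {..<b}. f p q)"
    by (rule sum.cartesian_product)
  also have "\<dots> = (\<Sum>k<a * b. f (k div b) (k mod b))"
  proof (rule sum.reindex_bij_witness[where i = "\<lambda>k. (k div b, k mod b)" and j = "\<lambda>(p, q). p * b + q"])
    fix x assume "x \<in> {..<a} \<times> {..<b}"
    then obtain p q where x: "x = (p, q)" "p < a" "q < b" by auto
    have "p * b + q < p * b + b" using x by simp
    also have "\<dots> = Suc p * b" by simp
    also have "\<dots> \<le> a * b" using x by (intro mult_le_mono1) simp
    finally show "(case x of (p, q) \<Rightarrow> p * b + q) \<in> {..<a * b}" by (simp add: x)
  next
    fix k assume "k \<in> {..<a * b}"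
    then have k: "k < a * b" by simp
    then have "b > 0" by (cases b) auto
    with k show "(k div b, k mod b) \<in> {..<a} \<times> {..<b}"
      by (simp add: less_mult_imp_div_less)
  qed auto
  finally show ?thesis ..
qed

text \<open>The inner summation index splits into quotient and remainder, and the resulting double
  sum factors into an entry of each product.\<close>

lemma kronecker_mult:
  fixes A B C D :: "'a::comm_ring_1 mat"
  assumes "A \<in> carrier_mat a a" "C \<in> carrier_mat a a" "B \<in> carrier_mat b b" "D \<in> carrier_mat b b"
  shows "kronecker A B * kronecker C D = kronecker (A * C) (B * D)"
proof (rule eq_matI)
  note [simp] = carrier_matD[OF assms(1)] carrier_matD[OF assms(2)] carrier_matD[OF assms(3)] carrier_matD[OF assms(4)]
  fix i j assume "i < dim_row (kronecker (A * C) (B * D))" "j < dim_col (kronecker (A * C) (B * D))"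
  then have ij: "i < a * b" "j < a * b" by (simp_all add: kronecker_def)
  \<comment> \<open>The existence of an index excludes \<open>b = 0\<close>, so that remainders are
    valid indices.\<close>
  then have "b > 0" by (cases b) auto
  with ij have div_mod: "i div b < a" "j div b < a" "i mod b < b" "j mod b < b"
    by (simp_all add: less_mult_imp_div_less)
  have "(kronecker A B * kronecker C D) $$ (i, j)
      = (\<Sum>k<a * b. (A $$ (i div b, k div b) * B $$ (i mod b, k mod b)) * (C $$ (k div b, j div b) * D $$ (k mod b, j mod b)))"
    using ij by (simp add: kronecker_def scalar_prod_def atLeast0LessThan)
  also have "\<dots> = (\<Sum>p<a. \<Sum>q<b. (A $$ (i div b, p) * B $$ (i mod b, q)) * (C $$ (p, j div b) * D $$ (q, j mod b)))"
    by (rule sum_div_mod[where f = "\<lambda>p q. (A $$ (i div b, p) * B $$ (i mod b, q)) * (C $$ (p, j div b) * D $$ (q, j mod b))"])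
  also have "\<dots> = (\<Sum>p<a. A $$ (i div b, p) * C $$ (p, j div b)) * (\<Sum>q<b. B $$ (i mod b, q) * D $$ (q, j mod b))"
    by (simp add: sum_product mult_ac)
  also have "\<dots> = kronecker (A * C) (B * D) $$ (i, j)"
    using ij div_mod by (simp add: kronecker_def scalar_prod_def atLeast0LessThan)
  finally show "(kronecker A B * kronecker C D) $$ (i, j) = kronecker (A * C) (B * D) $$ (i, j)" .
qed (use assms in \<open>simp_all add: kronecker_def\<close>)

lemma mat_trace_kronecker:
  fixes A B :: "'a::comm_semiring_1 mat"
  assumes "A \<in> carrier_mat a a" "B \<in> carrier_mat b b"
  shows "mat_trace (kronecker A B) = mat_trace A * mat_trace B"
proof -
  have "mat_trace (kronecker A B) = (\<Sum>k<a * b. A $$ (k div b, k div b) * B $$ (k mod b, k mod b))"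
    using assms by (simp add: mat_trace_def kronecker_def)
  also have "\<dots> = (\<Sum>p<a. \<Sum>q<b. A $$ (p, p) * B $$ (q, q))"
    by (rule sum_div_mod[where f = "\<lambda>p q. A $$ (p, p) * B $$ (q, q)"])
  finally show ?thesis
    using assms by (simp add: mat_trace_def sum_product)
qed

lemma kronecker_one: "kronecker (1\<^sub>m a) (1\<^sub>m b) = (1\<^sub>m (a * b) :: 'a::semiring_1 mat)"
proof (rule eq_matI)
  fix i j assume "i < dim_row (1\<^sub>m (a * b) :: 'a mat)" "j < dim_col (1\<^sub>m (a * b) :: 'a mat)"
  then have ij: "i < a * b" "j < a * b" by simp_all
  then have "b > 0" by (cases b) auto
  have "i = j \<longleftrightarrow> i div b = j div b \<and> i mod b = j mod b"
    by (metis div_mult_mod_eq)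
  with ij \<open>b > 0\<close> show "kronecker (1\<^sub>m a) (1\<^sub>m b) $$ (i, j) = (1\<^sub>m (a * b) :: 'a mat) $$ (i, j)"
    by (simp add: kronecker_def less_mult_imp_div_less)
qed (simp_all add: kronecker_def)

definition tensor :: "complex mat list \<Rightarrow> complex mat" where
  "tensor Ms = foldr kronecker Ms (1\<^sub>m 1)"

lemma tensor_simps [simp]:
  "tensor [] = 1\<^sub>m 1" "tensor (M # Ms) = kronecker M (tensor Ms)"
  by (simp_all add: tensor_def)

lemma tensor_carrier:
  "set Ms \<subseteq> carrier_mat 2 2 \<Longrightarrow> tensor Ms \<in> carrier_mat (2 ^ length Ms) (2 ^ length Ms)"
  by (induction Ms) (auto intro: kronecker_carrier)

lemma tensor_mult:
  assumes "length Ms = length Ns" "set Ms \<subseteq> carrier_mat 2 2" "set Ns \<subseteq> carrier_mat 2 2"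
  shows "tensor Ms * tensor Ns = tensor (map2 (*) Ms Ns)"
  using assms
proof (induction Ms Ns rule: list_induct2)
  case (Cons M Ms N Ns)
  then have "tensor Ms \<in> carrier_mat (2 ^ length Ms) (2 ^ length Ms)"
    "tensor Ns \<in> carrier_mat (2 ^ length Ms) (2 ^ length Ms)"
    using tensor_carrier[of Ms] tensor_carrier[of Ns] by auto
  with Cons show ?case
    by (simp add: kronecker_mult[of M 2 N])
qed simp

lemma mat_trace_tensor:
  "set Ms \<subseteq> carrier_mat 2 2 \<Longrightarrow> mat_trace (tensor Ms) = (\<Prod>M\<leftarrow>Ms. mat_trace M)"
proof (induction Ms)
  case Nil
  show ?case by (simp add: mat_trace_def)
next
  case (Cons M Ms)
  then show ?case
    using mat_trace_kronecker[of M 2 "tensor Ms"] tensor_carrier[of Ms] by simp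
qed

lemma tensor_ones: "tensor (replicate n (1\<^sub>m 2)) = 1\<^sub>m (2 ^ n)"
  by (induction n) (simp_all add: kronecker_one)

section \<open>The Pauli group\<close>

definition paulis :: "complex mat set" where
  "paulis = {pauli_I, pauli_X, pauli_Y, pauli_Z}"

lemmas pauli_defs = pauli_I_def pauli_X_def pauli_Y_def pauli_Z_def

lemma paulis_carrier: "paulis \<subseteq> carrier_mat 2 2"
  by (auto simp: paulis_def pauli_defs mat_of_rows_list_def)

lemma pauli_I_eq: "pauli_I = 1\<^sub>m 2"
  by (rule eq_matI) (auto simp: pauli_I_def mat_of_rows_list_def less_2_cases_iff)

lemma pauli_square:
  assumes "M \<in> paulis"
  shows "M * M = 1\<^sub>m 2"
  by (rule eq_matI)
    (use assms in \<open>auto simp: paulis_def pauli_defs mat_of_rows_list_def scalar_prod_def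
      atLeast0LessThan sum_lessThan_2 less_2_cases_iff\<close>)

lemma mat_trace_mult_2:
  assumes "A \<in> carrier_mat 2 2" "B \<in> carrier_mat 2 2"
  shows "mat_trace (A * B) = A $$ (0, 0) * B $$ (0, 0) + A $$ (0, 1) * B $$ (1, 0)
    + A $$ (1, 0) * B $$ (0, 1) + A $$ (1, 1) * B $$ (1, 1)"
  by (simp add: mat_trace_mult[OF assms] sum_lessThan_2 add.assoc)

text \<open>Orthogonality for the trace form serves twice: it tells group elements apart and shows
  that nonidentity strings have trace 0.\<close>

lemma pauli_orthogonal:
  assumes "M \<in> paulis" "N \<in> paulis" "M \<noteq> N"
  shows "mat_trace (M * N) = 0"
proof -
  have "M \<in> carrier_mat 2 2" "N \<in> carrier_mat 2 2"
    using assms paulis_carrier by auto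
  from mat_trace_mult_2[OF this] show ?thesis
    using assms by (auto simp: paulis_def pauli_defs mat_of_rows_list_def)
qed

lemma card_paulis: "card paulis = 4"
proof -
  have ne: "M \<noteq> N" if "M $$ p \<noteq> N $$ p" for M N :: "complex mat" and p
    using that by auto
  have "pauli_I \<noteq> pauli_X" "pauli_I \<noteq> pauli_Y" "pauli_X \<noteq> pauli_Z" "pauli_Y \<noteq> pauli_Z"
    by (rule ne[of _ "(0, 0)"], simp add: pauli_defs mat_of_rows_list_def)+
  moreover have "pauli_I \<noteq> pauli_Z"
    by (rule ne[of _ "(1, 1)"], simp add: pauli_defs mat_of_rows_list_def)
  moreover have "pauli_X \<noteq> pauli_Y"
    by (rule ne[of _ "(0, 1)"], simp add: pauli_defs mat_of_rows_list_def complex_eq_iff)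
  ultimately show ?thesis by (simp add: paulis_def)
qed

definition pauli_strings :: "nat \<Rightarrow> complex mat list set" where
  "pauli_strings n = {Ms. set Ms \<subseteq> paulis \<and> length Ms = n}"

lemma pauli_strings_carrier:
  assumes "Ms \<in> pauli_strings n"
  shows "set Ms \<subseteq> carrier_mat 2 2" "tensor Ms \<in> carrier_mat (2 ^ n) (2 ^ n)"
  using assms paulis_carrier tensor_carrier[of Ms] by (auto simp: pauli_strings_def)

lemma finite_pauli_strings: "finite (pauli_strings n)"
  unfolding pauli_strings_def by (rule finite_lists_length_eq) (simp add: paulis_def)

lemma card_pauli_strings: "card (pauli_strings n) = 4 ^ n"
  unfolding pauli_strings_def by (subst card_lists_length_eq) (simp_all add: card_paulis, simp add: paulis_def)

lemma tensor_pauli_square: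
  assumes "Ms \<in> pauli_strings n"
  shows "tensor Ms * tensor Ms = 1\<^sub>m (2 ^ n)"
proof -
  have "map2 (*) Ms Ms = replicate n (1\<^sub>m 2)"
  proof (rule nth_equalityI)
    fix i assume "i < length (map2 (*) Ms Ms)"
    then have i: "i < length Ms" by simp
    then have "Ms ! i \<in> paulis"
      using assms nth_mem[of i Ms] by (auto simp: pauli_strings_def)
    then show "map2 (*) Ms Ms ! i = replicate n (1\<^sub>m 2) ! i"
      using assms i by (simp add: pauli_square pauli_strings_def)
  qed (use assms in \<open>simp add: pauli_strings_def\<close>)
  then show ?thesis
    using pauli_strings_carrier(1)[OF assms] by (simp add: tensor_mult tensor_ones)
qed

text \<open>The trace is multiplicative over tensor factors, so one position where the strings
  differ already gives 0.\<close>

lemma mat_trace_tensor_pauli: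
  assumes "Ms \<in> pauli_strings n" "Ns \<in> pauli_strings n"
  shows "mat_trace (tensor Ms * tensor Ns) = (if Ms = Ns then 2 ^ n else 0)"
proof (cases "Ms = Ns")
  case True
  with tensor_pauli_square[OF assms(1)] show ?thesis by (simp add: mat_trace_def)
next
  case False
  have len: "length Ms = n" "length Ns = n"
    using assms by (simp_all add: pauli_strings_def)
  with False obtain i where i: "i < n" "Ms ! i \<noteq> Ns ! i"
    by (auto simp: list_eq_iff_nth_eq)
  with assms have "mat_trace (Ms ! i * Ns ! i) = 0"
    by (intro pauli_orthogonal) (auto simp: pauli_strings_def)
  then have "0 \<in> set (map mat_trace (map2 (*) Ms Ns))"
    using i len by (force simp: in_set_conv_nth)
  then have "(\<Prod>M\<leftarrow>map2 (*) Ms Ns. mat_trace M) = 0"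
    by (simp add: prod_list_zero_iff)
  moreover have "set (map2 (*) Ms Ns) \<subseteq> carrier_mat 2 2"
    using pauli_strings_carrier(1)[OF assms(1)] pauli_strings_carrier(1)[OF assms(2)]
    by (auto dest: set_zip_leftD set_zip_rightD intro!: mult_carrier_mat[of _ 2 2 _ 2])
  ultimately show ?thesis
    using False pauli_strings_carrier(1)[OF assms(1)] pauli_strings_carrier(1)[OF assms(2)] len
    by (simp add: tensor_mult mat_trace_tensor)
qed

definition fourth_roots :: "complex set" where
  "fourth_roots = {1, -1, \<i>, -\<i>}"

lemma pauli_group_eq:
  "pauli_group n = (\<lambda>(Ms, u). u \<cdot>\<^sub>m tensor Ms) ` (pauli_strings n \<times> fourth_roots)"
  by (auto simp: tensor_def pauli_group_def pauli_strings_def fourth_roots_def paulis_def image_iff)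

text \<open>
  Distinct Pauli strings are orthogonal for the trace form, so a matrix in the group determines
  its string and then its phase.
\<close>

lemma inj_on_scaled_tensor:
  "inj_on (\<lambda>(Ms, u). u \<cdot>\<^sub>m tensor Ms) (pauli_strings n \<times> fourth_roots)"
proof (rule inj_onI, clarify)
  fix Ms u Ns v
  assume Ms: "Ms \<in> pauli_strings n" and Ns: "Ns \<in> pauli_strings n"
    and u: "u \<in> fourth_roots" and eq: "u \<cdot>\<^sub>m tensor Ms = v \<cdot>\<^sub>m tensor Ns"
  \<comment> \<open>Pairing with \<open>tensor Ms\<close> reads off the phase if the strings agree
    and gives 0 otherwise.\<close>
  have trace: "mat_trace ((w \<cdot>\<^sub>m tensor Ls) * tensor Ms) = w * (if Ls = Ms then 2 ^ n else 0)"
    if Ls: "Ls \<in> pauli_strings n" for w Ls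
  proof -
    have "mat_trace ((w \<cdot>\<^sub>m tensor Ls) * tensor Ms) = w * mat_trace (tensor Ls * tensor Ms)"
      using pauli_strings_carrier(2)[OF Ls] pauli_strings_carrier(2)[OF Ms]
      by (simp add: mult_smult_assoc_mat[of _ "2 ^ n" "2 ^ n" _ "2 ^ n"] mat_trace_smult[of _ "2 ^ n"])
    then show ?thesis by (simp add: mat_trace_tensor_pauli[OF Ls Ms])
  qed
  have "u * 2 ^ n = v * (if Ns = Ms then 2 ^ n else 0)"
    using trace[OF Ms, of u] trace[OF Ns, of v] eq by simp
  moreover have "u \<noteq> 0" using u by (auto simp: fourth_roots_def)
  ultimately show "Ms = Ns \<and> u = v" by (auto split: if_splits)
qed

text \<open>This sum over the phases is the origin of the condition that 4 divides
  \<open>|\<tau>|\<close>. Powers depend only on \<open>k mod 4\<close>, leaving four cases.\<close>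

lemma sum_fourth_roots_power:
  "(\<Sum>u\<in>fourth_roots. u ^ k) = (if 4 dvd k then 4 else 0)"
proof -
  have "(\<Sum>u\<in>fourth_roots. u ^ k) = 1 + (-1) ^ k + \<i> ^ k + (-\<i>) ^ k"
    by (simp add: fourth_roots_def complex_eq_iff add.assoc)
  also have "\<dots> = 1 ^ (k mod 4) + (-1) ^ (k mod 4) + \<i> ^ (k mod 4) + (-\<i>) ^ (k mod 4)"
  proof -
    have "z ^ k = z ^ (k mod 4)" if "z ^ 4 = (1 :: complex)" for z
    proof -
      have "z ^ k = z ^ (4 * (k div 4) + k mod 4)" by simp
      also have "\<dots> = z ^ (k mod 4)" by (simp only: power_add power_mult that) simp
      finally show ?thesis .
    qed
    from this[of "-1"] this[of \<i>] this[of "-\<i>"] show ?thesis by simp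
  qed
  also have "\<dots> = (if 4 dvd k then 4 else 0)"
  proof -
    have "k mod 4 < 4" by simp
    then consider "k mod 4 = 0" | "k mod 4 = 1" | "k mod 4 = 2" | "k mod 4 = 3" by linarith
    then show ?thesis
      by cases (auto simp: dvd_eq_mod_eq_0 power3_eq_cube)
  qed
  finally show ?thesis .
qed

section \<open>Coefficients of the Pauli average\<close>

lemma multiplicative_coeff_pauli_A:
  "is_partition \<tau> \<Longrightarrow>
    multiplicative_coeff (\<lambda>m. of_nat ((2 ^ n + m - 1) choose m)) \<tau> = of_nat (pauli_A n \<tau>)"
  by (simp add: multiplicative_coeff_partition pauli_A_def)

lemma multiplicative_coeff_pauli_B:
  assumes "is_partition \<tau>"
  shows "multiplicative_coeff (\<lambda>m. if even m then of_nat ((2 ^ (n - 1) + m div 2 - 1) choose (m div 2)) else 0) \<tau>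
    = (if \<forall>r. even (Poly_Mapping.lookup \<tau> r) then of_nat (pauli_B n \<tau>) else (0 :: 'a::{comm_ring_1,semidom}))"
  by (subst multiplicative_coeff_even) (simp_all add: multiplicative_coeff_partition[OF assms] pauli_B_def)

lemma complete_at_eigenvalues_scalar:
  assumes "d \<ge> 1"
  shows "complete_at_eigenvalues (u \<cdot>\<^sub>m 1\<^sub>m d) = (\<lambda>m. of_nat ((d + m - 1) choose m) * u ^ m)"
proof (rule complete_at_eigenvalues_eqI)
  have "(u \<cdot>\<^sub>m 1\<^sub>m d) ^\<^sub>m i = u ^ i \<cdot>\<^sub>m 1\<^sub>m d" for i
    by (induction i) (auto intro!: eq_matI simp: mult.commute)
  then show "newton (\<lambda>i. mat_trace ((u \<cdot>\<^sub>m 1\<^sub>m d) ^\<^sub>m i)) (\<lambda>m. of_nat ((d + m - 1) choose m) * u ^ m)"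
    using newton_binomial[OF assms, of u] by (simp add: mat_trace_def)
qed auto

text \<open>The identity string gives a scalar matrix. Any other string is orthogonal to it, hence
  has trace 0, and its square is scalar. The factor \<open>u ^ m\<close> is kept separate so that
  the phase contributes \<open>u ^ degree_of \<tau>\<close>.\<close>

lemma complete_at_eigenvalues_pauli:
  assumes Ms: "Ms \<in> pauli_strings n" and "n \<ge> 1"
  shows "complete_at_eigenvalues (u \<cdot>\<^sub>m tensor Ms)
    = (if Ms = replicate n pauli_I then (\<lambda>m. of_nat ((2 ^ n + m - 1) choose m) * u ^ m)
       else (\<lambda>m. (if even m then of_nat ((2 ^ (n - 1) + m div 2 - 1) choose (m div 2)) else 0) * u ^ m))"
proof (cases "Ms = replicate n pauli_I")
  case True
  then show ?thesis
    by (simp add: pauli_I_eq tensor_ones complete_at_eigenvalues_scalar)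
next
  case False
  let ?A = "u \<cdot>\<^sub>m tensor Ms"
  have n: "2 * 2 ^ (n - 1) = (2 ^ n :: nat)"
    using assms(2) by (simp flip: power_Suc)
  note carrier = pauli_strings_carrier(2)[OF Ms]
  have I: "replicate n pauli_I \<in> pauli_strings n"
    by (auto simp: pauli_strings_def paulis_def)
  \<comment> \<open>The trace is a pairing with the identity string.\<close>
  have "mat_trace (tensor Ms * tensor (replicate n pauli_I)) = 0"
    using mat_trace_tensor_pauli[OF Ms I] False by simp
  then have "mat_trace (tensor Ms) = 0"
    using carrier by (simp add: pauli_I_eq tensor_ones)
  then have trace: "mat_trace ?A = 0"
    by (simp add: mat_trace_smult[OF carrier])
  have "?A * ?A = u \<cdot>\<^sub>m (u \<cdot>\<^sub>m (tensor Ms * tensor Ms))"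
    using carrier by (simp add: mult_smult_assoc_mat[of _ "2 ^ n" "2 ^ n" _ "2 ^ n"]
        mult_smult_distrib[of _ "2 ^ n" "2 ^ n" _ "2 ^ n"])
  also have "\<dots> = u ^ 2 \<cdot>\<^sub>m (tensor Ms * tensor Ms)"
    by (rule eq_matI) (simp_all add: power2_eq_square)
  finally have square: "?A * ?A = u ^ 2 \<cdot>\<^sub>m 1\<^sub>m (2 * 2 ^ (n - 1))"
    by (simp only: tensor_pauli_square[OF Ms] n)
  have "?A \<in> carrier_mat (2 * 2 ^ (n - 1)) (2 * 2 ^ (n - 1))"
    using carrier unfolding n by simp
  from complete_at_eigenvalues_square_scalar[OF this _ square trace] False show ?thesis
    by (auto simp: fun_eq_iff)
qed

text \<open>Strings and phases average independently. One of the \<open>4 ^ n\<close> strings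
  contributes \<open>A\<close>, the other \<open>4 ^ n - 1\<close> contribute \<open>B\<close>, or 0
  if some part is odd; this gives \<open>(A + (4^n - 1) B) / 4^n\<close>.\<close>

lemma mcoeff_sigma_mgf_pauli:
  assumes \<tau>: "is_partition \<tau>" and "n \<ge> 1"
  shows "mcoeff (sigma_mgf (pauli_group n)) \<tau> = pauli_coeff n \<tau>"
proof -
  let ?I = "replicate n pauli_I"
  let ?B = "if \<forall>r. even (Poly_Mapping.lookup \<tau> r) then of_nat (pauli_B n \<tau>) else 0 :: complex"
  let ?U = "if 4 dvd degree_of \<tau> then 4 else 0 :: complex"
  have I: "?I \<in> pauli_strings n"
    by (auto simp: pauli_strings_def paulis_def)
  have "card fourth_roots = 4"
    by (simp add: fourth_roots_def complex_eq_iff)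
  then have card: "card (pauli_group n) = 4 * 4 ^ n"
    by (simp add: pauli_group_eq card_image[OF inj_on_scaled_tensor] card_cartesian_product card_pauli_strings)
  have coeff: "multiplicative_coeff (complete_at_eigenvalues (u \<cdot>\<^sub>m tensor Ms)) \<tau>
      = (if Ms = ?I then of_nat (pauli_A n \<tau>) else ?B) * u ^ degree_of \<tau>" if "Ms \<in> pauli_strings n" for Ms u
    by (simp only: complete_at_eigenvalues_pauli[OF that assms(2)] if_distrib[of multiplicative_coeff]
        if_distribR multiplicative_coeff_mult multiplicative_coeff_power
        multiplicative_coeff_pauli_A[OF \<tau>] multiplicative_coeff_pauli_B[OF \<tau>] split: if_split) simp
  have "(\<Sum>g\<in>pauli_group n. multiplicative_coeff (complete_at_eigenvalues g) \<tau>)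
      = (\<Sum>Ms\<in>pauli_strings n. \<Sum>u\<in>fourth_roots. multiplicative_coeff (complete_at_eigenvalues (u \<cdot>\<^sub>m tensor Ms)) \<tau>)"
    unfolding pauli_group_eq sum.reindex[OF inj_on_scaled_tensor] sum.cartesian_product
    by (rule sum.cong) auto
  also have "\<dots> = (\<Sum>Ms\<in>pauli_strings n. (if Ms = ?I then of_nat (pauli_A n \<tau>) else ?B) * ?U)"
    by (rule sum.cong[OF refl]) (simp only: coeff sum_distrib_left[symmetric] sum_fourth_roots_power)
  also have "\<dots> = (of_nat (pauli_A n \<tau>) + (4 ^ n - 1) * ?B) * ?U"
  proof -
    have "(\<Sum>Ms\<in>pauli_strings n - {?I}. (if Ms = ?I then of_nat (pauli_A n \<tau>) else ?B)) = (\<Sum>Ms\<in>pauli_strings n - {?I}. ?B)"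
      by (rule sum.cong) auto
    also have "\<dots> = (4 ^ n - 1) * ?B"
      using I by (simp add: card_Diff_subset card_pauli_strings of_nat_diff)
    finally have "(\<Sum>Ms\<in>pauli_strings n. (if Ms = ?I then of_nat (pauli_A n \<tau>) else ?B))
        = of_nat (pauli_A n \<tau>) + (4 ^ n - 1) * ?B"
      using sum.remove[OF finite_pauli_strings I, of "\<lambda>Ms. if Ms = ?I then of_nat (pauli_A n \<tau>) else ?B"] by simp
    then show ?thesis by (simp only: sum_distrib_right[symmetric])
  qed
  finally have sum: "(\<Sum>g\<in>pauli_group n. multiplicative_coeff (complete_at_eigenvalues g) \<tau>)
      = (of_nat (pauli_A n \<tau>) + (4 ^ n - 1) * ?B) * ?U" .
  show ?thesis
    unfolding mcoeff_sigma_mgf card pauli_coeff_def sum by (auto simp: field_simps)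
qed

text \<open>The two plethystic exponentials have the coefficients \<open>A\<close> and, on
  partitions with even parts only, \<open>B\<close>; their weights are the proportions of identity
  and nonidentity strings.\<close>

lemma mcoeff_pauli_Exp_sigma:
  assumes "is_partition \<tau>" "4 dvd degree_of \<tau>"
  shows "mcoeff (map_mps of_rat
      (mps_const (1 / 4 ^ n) * Exp_sigma (2 ^ n * power_sum 1)
        + mps_const (1 - 1 / 4 ^ n) * Exp_sigma (2 ^ (n - 1) * power_sum 2))) \<tau> = pauli_coeff n \<tau>"
proof -
  have A: "of_rat (mcoeff (Exp_sigma (2 ^ n * power_sum 1)) \<tau>) = (of_nat (pauli_A n \<tau>) :: complex)"
    using mcoeff_Exp_sigma_of_nat_power_sum[of "2 ^ n" 1 \<tau>, where 'a = complex]
      multiplicative_coeff_pauli_A[OF assms(1), of n, where 'a = complex]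
    by (simp add: map_mps_def)
  have B: "of_rat (mcoeff (Exp_sigma (2 ^ (n - 1) * power_sum 2)) \<tau>)
      = (if \<forall>r. even (Poly_Mapping.lookup \<tau> r) then of_nat (pauli_B n \<tau>) else (0 :: complex))"
    using mcoeff_Exp_sigma_of_nat_power_sum[of "2 ^ (n - 1)" 2 \<tau>, where 'a = complex]
      multiplicative_coeff_pauli_B[OF assms(1), of n, where 'a = complex]
    by (simp add: map_mps_def)
  show ?thesis
    unfolding map_mps_def mcoeff_MPS plus_mps.rep_eq mcoeff_const_times of_rat_add of_rat_mult A B
    using assms(2) by (auto simp: pauli_coeff_def of_rat_diff of_rat_divide of_rat_power field_simps)
qed

theorem theorem1:
  shows "(\<forall>n\<ge>1. sigma_mgf (cyclic_matrices n)
             = monomial_sum (\<lambda>\<tau>. if n dvd degree_of \<tau> then 1 else 0))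
    \<and> (\<forall>n\<ge>1. sigma_mgf (dihedral_matrices n)
             = mps_const (1 / 2) * monomial_sum (\<lambda>\<tau>. of_nat (card (dihedral_tuples n \<tau>)))
               + mps_const (1 / 2) * map_mps of_rat (Exp_sigma (power_sum 2)))
    \<and> (\<forall>n\<ge>1. sigma_mgf (pauli_group n) = monomial_sum (pauli_coeff n)
         \<and> (\<forall>\<tau>. is_partition \<tau> \<longrightarrow>
               mcoeff (sigma_mgf (pauli_group n)) \<tau>
               = (if \<not> 4 dvd degree_of \<tau> then 0
                  else mcoeff (map_mps of_rat
                         (mps_const (1 / 4 ^ n) * Exp_sigma (2 ^ n * power_sum 1)
                          + mps_const (1 - 1 / 4 ^ n)
                              * Exp_sigma (2 ^ (n - 1) * power_sum 2))) \<tau>)))"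
proof (intro conjI allI impI)
  fix n :: nat assume n: "n \<ge> 1"
  show "sigma_mgf (cyclic_matrices n) = monomial_sum (\<lambda>\<tau>. if n dvd degree_of \<tau> then 1 else 0)"
    by (rule sigma_mgf_cyclic[OF n])
  show "sigma_mgf (dihedral_matrices n)
      = mps_const (1 / 2) * monomial_sum (\<lambda>\<tau>. of_nat (card (dihedral_tuples n \<tau>)))
        + mps_const (1 / 2) * map_mps of_rat (Exp_sigma (power_sum 2))"
    by (rule sigma_mgf_dihedral[OF n])
  show "sigma_mgf (pauli_group n) = monomial_sum (pauli_coeff n)"
    by (rule sigma_mgf_eqI) (rule mcoeff_sigma_mgf_pauli[OF _ n])
  fix \<tau> assume \<tau>: "is_partition \<tau>"
  show "mcoeff (sigma_mgf (pauli_group n)) \<tau>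
      = (if \<not> 4 dvd degree_of \<tau> then 0
         else mcoeff (map_mps of_rat
                (mps_const (1 / 4 ^ n) * Exp_sigma (2 ^ n * power_sum 1)
                 + mps_const (1 - 1 / 4 ^ n) * Exp_sigma (2 ^ (n - 1) * power_sum 2))) \<tau>)"
  proof (cases "4 dvd degree_of \<tau>")
    case True
    then show ?thesis
      by (simp only: mcoeff_sigma_mgf_pauli[OF \<tau> n] mcoeff_pauli_Exp_sigma[OF \<tau> True] simp_thms if_False)
  next
    case False
    then show ?thesis by (simp add: mcoeff_sigma_mgf_pauli[OF \<tau> n] pauli_coeff_def)
  qed
qed

end
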